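(* Let $X$ be a locale whose frame is given by a $\mathbf{PreFrm}$-type presentation $\mathcal{O}X = \langle G \text{ } \vee\text{-semilattice} \mid R\rangle_{\mathbf{Frm}}$, and let $q\colon X \twoheadrightarrow Y$ be a proper quotient. Then $$\mathcal{O}Y \cong \langle \Box g,\ g \in G \mid R,\ \Box 0 = 0,\ \Box s \vee \Box t = \Box(s \vee q^*q_*(t)),\ s,t \in G\rangle_{\mathbf{Frm}},$$ where the generators $\Box g$ are indexed by the underlying set of $G$; $\Box(s\vee q^*q_*(t))$ is interpreted as $\bigvee^{\uparrow}_{\beta}\bigwedge_{j_\beta} \Box(s \vee t_\beta^{j_\beta})$ for a specified representation $q^*q_*(t) = \bigvee^{\uparrow}_{\beta}\bigwedge_{j_\beta} t_\beta^{j_\beta}$ in $\mathcal{O}X$ as a directed join of finite meets of generators from $G$ (with $s \vee t_\beta^{j_\beta}$ computed in $G$); and each relation of $R$ is read with every generator $g$ replaced by $\Box g$.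
   Context: For a locale $X$, $\mathcal{O}X$ denotes its frame; a locale map $f\colon X\to Y$ corresponds to a frame homomorphism $f^*\colon\mathcal{O}Y\to\mathcal{O}X$ with right adjoint $f_*\colon\mathcal{O}X\to\mathcal{O}Y$. $f$ is proper if $f_*$ preserves directed joins and satisfies $f_*(a\vee f^*(b)) = f_*(a)\vee b$; a proper quotient is an epic (i.e. $f^*$ injective) proper map. $\bigvee^{\uparrow}$ denotes a join of a directed family. $\langle G\mid R\rangle_{\mathbf{Frm}}$ denotes the frame presented by generators $G$ and relations $R$ (formal equalities and inequalities between elements of the free frame on $G$); "$G$ $\vee$-semilattice" means the free frame on the $\vee$-semilattice $G$ is used (equivalently, relations are added forcing finite joins, including the bottom $0$, to agree with those in $G$). Semilattices are unital. A presentation $\langle G \text{ }\vee\text{-semilattice}\mid R\rangle_{\mathbf{Frm}}$ is $\mathbf{PreFrm}$-type if every relation in $R$ has the form $\bigvee^{\uparrow}_\alpha\bigwedge A_\alpha \le \bigvee^{\uparrow}_\beta\bigwedge B_\beta$ with each $A_\alpha, B_\beta\subseteq G$ finite, and whenever this is in $R$, so is $\bigvee^{\uparrow}_\alpha\bigwedge_{a\in A_\alpha}(a\vee c) \le \bigvee^{\uparrow}_\beta\bigwedge_{b\in B_\beta}(b\vee c)$ for each $c\in G$.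
   Formalization: For an arbitrary specified representation of q^*q_*(t) the listed relations do not suffice; the formal theorem adds □s ≤ □t for s ≤ t in that case, and proves the presentation exactly as listed for some choice of representations. *)

theory Defs
  imports "HOL-Library.FSet"
begin

section \<open>Frames and locale maps\<close>

class frame = complete_lattice +
  assumes inf_Sup_frame: "inf a (Sup B) = (SUP b\<in>B. inf a b)"

definition frame_hom :: "('a::frame \<Rightarrow> 'b::frame) \<Rightarrow> bool" where
  "frame_hom h \<longleftrightarrow>
     (\<forall>S. h (Sup S) = (SUP u\<in>S. h u)) \<and> (\<forall>u v. h (inf u v) = inf (h u) (h v)) \<and> h top = top"

definition directed :: "('a \<Rightarrow> 'a \<Rightarrow> bool) \<Rightarrow> 'a set \<Rightarrow> bool" where
  "directed le D \<longleftrightarrow> D \<noteq> {} \<and> (\<forall>x\<in>D. \<forall>y\<in>D. \<exists>z\<in>D. le x z \<and> le y z)"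

definition right_adjoint :: "('a::frame \<Rightarrow> 'b::frame) \<Rightarrow> 'b \<Rightarrow> 'a" where
  "right_adjoint h a = Sup {b. h b \<le> a}"

lemma right_adjoint_iff:
  assumes "frame_hom h"
  shows "h b \<le> a \<longleftrightarrow> b \<le> right_adjoint h a"
proof
  assume b: "b \<le> right_adjoint h a"
  have "h (Sup {b, right_adjoint h a}) = Sup (h ` {b, right_adjoint h a})"
    using assms unfolding frame_hom_def by blast
  then have "h (right_adjoint h a) = sup (h b) (h (right_adjoint h a))"
    using b by (simp add: sup.absorb2)
  then have "h b \<le> h (right_adjoint h a)"
    by (simp only: le_iff_sup)
  also have "\<dots> = (SUP c\<in>{c. h c \<le> a}. h c)"
    using assms by (simp add: frame_hom_def right_adjoint_def)
  also have "\<dots> \<le> a" by (auto intro: SUP_least)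
  finally show "h b \<le> a" .
qed (auto simp: right_adjoint_def intro: Sup_upper)

text \<open>A locale map \<open>q : X \<rightarrow> Y\<close> is given by its frame homomorphism
  \<open>q\<^sup>* : OY \<rightarrow> OX\<close>, and \<open>q\<^sub>*\<close> is \<^term>\<open>right_adjoint q\<close>.\<close>

definition proper_map :: "('y::frame \<Rightarrow> 'x::frame) \<Rightarrow> bool" where
  "proper_map q \<longleftrightarrow> frame_hom q \<and>
     (\<forall>D. directed (\<le>) D \<longrightarrow> right_adjoint q (Sup D) = (SUP d\<in>D. right_adjoint q d)) \<and>
     (\<forall>a b. right_adjoint q (sup a (q b)) = sup (right_adjoint q a) b)"

definition proper_quotient :: "('y::frame \<Rightarrow> 'x::frame) \<Rightarrow> bool" where
  "proper_quotient q \<longleftrightarrow> proper_map q \<and> inj q"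

section \<open>Free frames\<close>

text \<open>The free frame on a set is the frame of upwards closed collections of finite subsets,
  such a collection \<open>U\<close> standing for the formal join over \<open>A \<in> U\<close> of the formal meets of \<open>A\<close>.\<close>

typedef 'g free_frame = "{U :: 'g fset set. \<forall>A\<in>U. \<forall>B. A |\<subseteq>| B \<longrightarrow> B \<in> U}"
  by auto

setup_lifting type_definition_free_frame

instantiation free_frame :: (type) frame
begin

lift_definition less_eq_free_frame :: "'a free_frame \<Rightarrow> 'a free_frame \<Rightarrow> bool" is "(\<subseteq>)" .
lift_definition less_free_frame :: "'a free_frame \<Rightarrow> 'a free_frame \<Rightarrow> bool" is "(\<subset>)" .
lift_definition inf_free_frame :: "'a free_frame \<Rightarrow> 'a free_frame \<Rightarrow> 'a free_frame" is "(\<inter>)"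
  by auto
lift_definition sup_free_frame :: "'a free_frame \<Rightarrow> 'a free_frame \<Rightarrow> 'a free_frame" is "(\<union>)"
  by auto
lift_definition bot_free_frame :: "'a free_frame" is "{}" by auto
lift_definition top_free_frame :: "'a free_frame" is UNIV by auto
lift_definition Inf_free_frame :: "'a free_frame set \<Rightarrow> 'a free_frame" is "\<lambda>S. \<Inter>S"
  by (rule InterI) (metis InterD)
lift_definition Sup_free_frame :: "'a free_frame set \<Rightarrow> 'a free_frame" is "\<lambda>S. \<Union>S"
  by (erule UnionE, rule UnionI)

instance
  by standard
    (auto simp: less_eq_free_frame.rep_eq less_free_frame.rep_eq inf_free_frame.rep_eq
      sup_free_frame.rep_eq bot_free_frame.rep_eq top_free_frame.rep_eq Inf_free_frame.rep_eq
      Sup_free_frame.rep_eq Rep_free_frame_inject[symmetric])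

end

lift_definition gen :: "'g \<Rightarrow> 'g free_frame" is "\<lambda>g. {A. g |\<in>| A}"
  by auto

text \<open>Interpretation of a family of finite sets of generators, read as the join of its finite
  meets. A family indexed by \<open>\<alpha>\<close> is represented by its set of members.\<close>

definition meet_of :: "('g \<Rightarrow> 'a::frame) \<Rightarrow> 'g fset \<Rightarrow> 'a" where
  "meet_of f A = (INF a\<in>fset A. f a)"

definition join_meet :: "('g \<Rightarrow> 'a::frame) \<Rightarrow> 'g fset set \<Rightarrow> 'a" where
  "join_meet f \<A> = (SUP A\<in>\<A>. meet_of f A)"

definition free_ext :: "('g \<Rightarrow> 'a::frame) \<Rightarrow> 'g free_frame \<Rightarrow> 'a" where
  "free_ext f u = join_meet f (Rep_free_frame u)"

lemma meet_of_funion: "meet_of f (A |\<union>| B) = inf (meet_of f A) (meet_of f B)"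
  by (simp add: meet_of_def INF_union)

lemma meet_of_antimono: "A |\<subseteq>| B \<Longrightarrow> meet_of f B \<le> meet_of f A"
  by (auto simp: meet_of_def less_eq_fset.rep_eq intro: INF_superset_mono)

lemma frame_hom_meet_of: "frame_hom h \<Longrightarrow> h (meet_of f A) = meet_of (h \<circ> f) A"
  by (induction A) (simp_all add: meet_of_def frame_hom_def)

lemma Rep_meet_of_gen: "Rep_free_frame (meet_of gen A) = {B. A |\<subseteq>| B}"
  by (induction A) (auto simp: meet_of_def top_free_frame.rep_eq inf_free_frame.rep_eq gen.rep_eq)

lemma free_frame_expand: "u = join_meet gen (Rep_free_frame u)"
proof -
  have "Rep_free_frame (join_meet gen (Rep_free_frame u)) = Rep_free_frame u"
    using Rep_free_frame[of u]
    by (auto simp: join_meet_def Sup_free_frame.rep_eq Rep_meet_of_gen)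
  then show ?thesis by (simp add: Rep_free_frame_inject)
qed

lemma free_ext_gen: "free_ext f (gen g) = f g"
proof (rule antisym)
  show "free_ext f (gen g) \<le> f g"
    by (auto simp: free_ext_def join_meet_def meet_of_def gen.rep_eq intro!: SUP_least INF_lower)
  have "f g = meet_of f {|g|}" by (simp add: meet_of_def)
  also have "\<dots> \<le> free_ext f (gen g)"
    unfolding free_ext_def join_meet_def by (rule SUP_upper) (simp add: gen.rep_eq)
  finally show "f g \<le> free_ext f (gen g)" .
qed

lemma frame_hom_free_ext: "frame_hom (free_ext f)"
  unfolding frame_hom_def
proof (intro conjI allI)
  show "free_ext f (Sup S) = (SUP u\<in>S. free_ext f u)" for S
    unfolding free_ext_def join_meet_def Sup_free_frame.rep_eq
    by (rule antisym) (auto intro!: SUP_least intro: SUP_upper2 SUP_upper)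
  show "free_ext f top = top"
  proof -
    have "top = meet_of f {||}" by (simp add: meet_of_def)
    also have "\<dots> \<le> free_ext f top"
      unfolding free_ext_def join_meet_def by (rule SUP_upper) (simp add: top_free_frame.rep_eq)
    finally show ?thesis by (simp add: top_unique)
  qed
  show "free_ext f (inf u v) = inf (free_ext f u) (free_ext f v)" for u v
  proof (rule antisym)
    show "free_ext f (inf u v) \<le> inf (free_ext f u) (free_ext f v)"
      unfolding free_ext_def join_meet_def inf_free_frame.rep_eq
      by (auto intro!: SUP_subset_mono)
    have "inf (meet_of f A) (meet_of f B) \<le> free_ext f (inf u v)"
      if "A \<in> Rep_free_frame u" "B \<in> Rep_free_frame v" for A B
    proof -
      have "A |\<union>| B \<in> Rep_free_frame (inf u v)"
        using that Rep_free_frame[of u] Rep_free_frame[of v]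
        by (auto simp: inf_free_frame.rep_eq)
      then show ?thesis
        unfolding free_ext_def join_meet_def
        by (intro SUP_upper2[of "A |\<union>| B"]) (simp_all add: meet_of_funion)
    qed
    then have "inf (free_ext f v) (meet_of f A) \<le> free_ext f (inf u v)" if "A \<in> Rep_free_frame u" for A
      using that
      by (subst inf.commute)
         (auto simp: free_ext_def[of f v] join_meet_def inf_Sup_frame image_image intro!: SUP_least)
    then show "inf (free_ext f u) (free_ext f v) \<le> free_ext f (inf u v)"
      by (subst inf.commute)
         (auto simp: free_ext_def[of f u] join_meet_def inf_Sup_frame image_image intro!: SUP_least)
  qed
qed

theorem free_frame_universal: "\<exists>!h. frame_hom h \<and> (\<forall>g. h (gen g) = f g)"
proof (rule ex1I[of _ "free_ext f"])
  show "frame_hom (free_ext f) \<and> (\<forall>g. free_ext f (gen g) = f g)"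
    by (simp add: frame_hom_free_ext free_ext_gen)
  fix h assume h: "frame_hom h \<and> (\<forall>g. h (gen g) = f g)"
  show "h = free_ext f"
  proof
    fix u
    have "h u = h (join_meet gen (Rep_free_frame u))" using free_frame_expand by metis
    also have "\<dots> = join_meet (h \<circ> gen) (Rep_free_frame u)"
      using h unfolding join_meet_def
      by (simp add: frame_hom_def image_image) (simp add: frame_hom_meet_of h)
    also have "h \<circ> gen = f" using h by auto
    finally show "h u = free_ext f u" by (simp add: free_ext_def)
  qed
qed

section \<open>Presented frames\<close>

text \<open>Relations are pairs \<open>(u, v)\<close> of elements of the free frame, read as \<open>u \<le> v\<close>.\<close>

definition eqs :: "('a \<times> 'a) set \<Rightarrow> ('a \<times> 'a) set" where
  "eqs E = E \<union> E\<inverse>"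

definition frame_congruence :: "('a::frame \<times> 'a) set \<Rightarrow> bool" where
  "frame_congruence \<theta> \<longleftrightarrow> equiv UNIV \<theta> \<and>
     (\<forall>u u' v v'. (u, u') \<in> \<theta> \<longrightarrow> (v, v') \<in> \<theta> \<longrightarrow> (inf u v, inf u' v') \<in> \<theta>) \<and>
     (\<forall>S. S \<subseteq> \<theta> \<longrightarrow> (Sup (fst ` S), Sup (snd ` S)) \<in> \<theta>)"

definition generated_cong :: "('a::frame \<times> 'a) set \<Rightarrow> ('a \<times> 'a) set" where
  "generated_cong R = \<Inter>{\<theta>. frame_congruence \<theta> \<and> (\<forall>(u, v)\<in>R. (inf u v, u) \<in> \<theta>)}"

definition cls :: "('g free_frame \<times> 'g free_frame) set \<Rightarrow> 'g free_frame \<Rightarrow> 'g free_frame set" where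
  "cls R u = generated_cong R `` {u}"

definition presented_frame :: "('g free_frame \<times> 'g free_frame) set \<Rightarrow> 'g free_frame set set" where
  "presented_frame R = UNIV // generated_cong R"

definition cls_le :: "('g free_frame \<times> 'g free_frame) set \<Rightarrow> 'g free_frame \<Rightarrow> 'g free_frame \<Rightarrow> bool" where
  "cls_le R u v \<longleftrightarrow> cls R (inf u v) = cls R u"

text \<open>The frame operations of the presented frame are the unique ones making \<^term>\<open>cls R\<close> a frame
  homomorphism, so the second clause says that \<open>\<phi>\<close> is a frame homomorphism.\<close>

definition presentation_iso ::
    "('g free_frame \<times> 'g free_frame) set \<Rightarrow> ('g free_frame set \<Rightarrow> 'a::frame) \<Rightarrow> bool" where
  "presentation_iso R \<phi> \<longleftrightarrow>
     bij_betw \<phi> (presented_frame R) UNIV \<and> frame_hom (\<lambda>u. \<phi> (cls R u))"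

lemma frame_congruence_kernel:
  assumes "frame_hom h"
  shows "frame_congruence {(u, v). h u = h v}"
  unfolding frame_congruence_def
proof (intro conjI allI impI)
  show "equiv UNIV {(u, v). h u = h v}"
    by (auto simp: equiv_def refl_on_def sym_def trans_def)
  show "(inf u v, inf u' v') \<in> {(u, v). h u = h v}"
    if "(u, u') \<in> {(u, v). h u = h v}" "(v, v') \<in> {(u, v). h u = h v}" for u u' v v'
    using that assms by (simp add: frame_hom_def)
  show "(Sup (fst ` S), Sup (snd ` S)) \<in> {(u, v). h u = h v}"
    if "S \<subseteq> {(u, v). h u = h v}" for S
  proof -
    have "(\<lambda>p. h (fst p)) ` S = (\<lambda>p. h (snd p)) ` S"
      using that by (intro image_cong) auto
    then show ?thesis using assms by (simp add: frame_hom_def image_image)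
  qed
qed

lemma frame_congruence_generated: "frame_congruence (generated_cong R)"
proof -
  define C where "C = {\<theta>. frame_congruence \<theta> \<and> (\<forall>(u, v)\<in>R. (inf u v, u) \<in> \<theta>)}"
  have eq: "equiv UNIV \<theta>" if "\<theta> \<in> C" for \<theta>
    using that by (simp add: C_def frame_congruence_def)
  have inf: "(inf u v, inf u' v') \<in> \<theta>" if "\<theta> \<in> C" "(u, u') \<in> \<theta>" "(v, v') \<in> \<theta>" for \<theta> u u' v v'
    using that by (simp add: C_def frame_congruence_def)
  have Sup: "(Sup (fst ` S), Sup (snd ` S)) \<in> \<theta>" if "\<theta> \<in> C" "S \<subseteq> \<theta>" for \<theta> S
    using that by (simp add: C_def frame_congruence_def)
  have "frame_congruence (\<Inter>C)"
    unfolding frame_congruence_def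
  proof (intro conjI allI impI equivI)
    show "refl (\<Inter>C)" using eq by (auto simp: refl_on_def equiv_def)
    show "sym (\<Inter>C)" using eq by (auto intro!: symI simp: equiv_def dest: symD)
    show "trans (\<Inter>C)"
    proof (intro transI InterI)
      fix u v w \<theta> assume "(u, v) \<in> \<Inter>C" "(v, w) \<in> \<Inter>C" "\<theta> \<in> C"
      then show "(u, w) \<in> \<theta>" using eq[of \<theta>] by (auto simp: equiv_def elim: transE)
    qed
    show "(inf u v, inf u' v') \<in> \<Inter>C" if "(u, u') \<in> \<Inter>C" "(v, v') \<in> \<Inter>C" for u u' v v'
      using that inf by auto
    show "(Sup (fst ` S), Sup (snd ` S)) \<in> \<Inter>C" if "S \<subseteq> \<Inter>C" for S
    proof (rule InterI)
      fix \<theta> assume "\<theta> \<in> C"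
      with that have "S \<subseteq> \<theta>" by (meson Inter_lower subset_trans)
      with \<open>\<theta> \<in> C\<close> show "(Sup (fst ` S), Sup (snd ` S)) \<in> \<theta>" by (rule Sup)
    qed
  qed simp
  then show ?thesis by (simp add: generated_cong_def C_def)
qed

lemma cls_eq_iff: "cls R u = cls R v \<longleftrightarrow> (u, v) \<in> generated_cong R"
proof -
  have "equiv UNIV (generated_cong R)"
    using frame_congruence_generated[of R] by (simp only: frame_congruence_def)
  then show ?thesis unfolding cls_def by (simp add: eq_equiv_class_iff)
qed

lemma cls_le_relation: "(u, v) \<in> R \<Longrightarrow> cls_le R u v"
  unfolding cls_le_def cls_eq_iff by (auto simp: generated_cong_def)

lemma generated_cong_kernel:
  assumes "frame_hom h" and "\<forall>(u, v)\<in>R. h u \<le> h v" and "(u, v) \<in> generated_cong R"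
  shows "h u = h v"
proof -
  have "\<forall>(u, v)\<in>R. (inf u v, u) \<in> {(u, v). h u = h v}"
    using assms(1,2) by (auto simp: frame_hom_def inf.absorb1)
  then have "(u, v) \<in> {(u, v). h u = h v}"
    using frame_congruence_kernel[OF assms(1)]
    by (intro InterD[OF assms(3)[unfolded generated_cong_def]] CollectI conjI)
  then show ?thesis by simp
qed

text \<open>Universal property: a valuation \<open>f\<close> of the generators validating \<open>R\<close> factors uniquely
  through the presented frame.\<close>

theorem presented_frame_universal:
  fixes f :: "'g \<Rightarrow> 'a::frame"
  assumes "\<forall>(u, v)\<in>R. free_ext f u \<le> free_ext f v"
  shows "\<exists>\<psi>. frame_hom (\<lambda>u. \<psi> (cls R u)) \<and> (\<forall>g. \<psi> (cls R (gen g)) = f g) \<and>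
    (\<forall>\<psi>'. frame_hom (\<lambda>u. \<psi>' (cls R u)) \<and> (\<forall>g. \<psi>' (cls R (gen g)) = f g) \<longrightarrow>
       (\<forall>c\<in>presented_frame R. \<psi>' c = \<psi> c))"
proof -
  define \<psi> where "\<psi> c = free_ext f (SOME u. cls R u = c)" for c
  have \<psi>: "\<psi> (cls R u) = free_ext f u" for u
  proof -
    have "cls R (SOME v. cls R v = cls R u) = cls R u"
      by (rule someI[of "\<lambda>v. cls R v = cls R u"]) simp
    then show ?thesis
      unfolding \<psi>_def cls_eq_iff by (rule generated_cong_kernel[OF frame_hom_free_ext assms])
  qed
  have uniq: "\<psi>' (cls R u) = free_ext f u"
    if "frame_hom (\<lambda>u. \<psi>' (cls R u))" "\<forall>g. \<psi>' (cls R (gen g)) = f g" for \<psi>' u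
  proof -
    have "(\<lambda>u. \<psi>' (cls R u)) = free_ext f"
      by (rule free_frame_universal[of f, THEN ex1_iff_ex_Uniq[THEN iffD1], THEN conjunct2, THEN Uniq_D])
        (use that in \<open>simp_all add: frame_hom_free_ext free_ext_gen\<close>)
    then show ?thesis by (rule fun_cong)
  qed
  show ?thesis
  proof (intro exI[of _ \<psi>] conjI allI impI ballI)
    show "frame_hom (\<lambda>u. \<psi> (cls R u))" by (simp add: \<psi> frame_hom_free_ext)
    show "\<psi> (cls R (gen g)) = f g" for g by (simp add: \<psi> free_ext_gen)
    show "\<psi>' c = \<psi> c" if "frame_hom (\<lambda>u. \<psi>' (cls R u)) \<and> (\<forall>g. \<psi>' (cls R (gen g)) = f g)"
      and c: "c \<in> presented_frame R" for \<psi>' c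
    proof -
      obtain u where "c = cls R u"
        using c by (auto simp: presented_frame_def cls_def elim: quotientE)
      then show ?thesis using that(1) \<psi> uniq by simp
    qed
  qed
qed

section \<open>PreFrm-type presentations over a join-semilattice\<close>

definition join_relations ::
    "('g::bounded_semilattice_sup_bot free_frame \<times> 'g free_frame) set" where
  "join_relations = eqs ({(gen bot, bot)} \<union> {(gen (sup s t), sup (gen s) (gen t)) | s t. True})"

definition shift :: "'g::semilattice_sup \<Rightarrow> 'g fset set \<Rightarrow> 'g fset set" where
  "shift c \<A> = (\<lambda>A. (\<lambda>a. sup a c) |`| A) ` \<A>"

text \<open>A formal relation \<open>(\<A>, \<B>)\<close> is an inequality between elements of the free frame on the
  join-semilattice \<open>G\<close>; the families are directed there.\<close>

definition formally_directed :: "'g::bounded_semilattice_sup_bot fset set \<Rightarrow> bool" where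
  "formally_directed \<A> \<longleftrightarrow> directed (cls_le join_relations) (meet_of gen ` \<A>)"

definition preframe_type ::
    "('g::bounded_semilattice_sup_bot fset set \<times> 'g fset set) set \<Rightarrow> bool" where
  "preframe_type R \<longleftrightarrow> (\<forall>(\<A>, \<B>)\<in>R. formally_directed \<A> \<and> formally_directed \<B> \<and>
     (\<forall>c. (shift c \<A>, shift c \<B>) \<in> R))"

text \<open>The relations \<open>R\<close>, with each generator read as the corresponding generator of the free frame
  on the underlying set of \<open>G\<close>.\<close>

definition formal_relations ::
    "('g fset set \<times> 'g fset set) set \<Rightarrow> ('g free_frame \<times> 'g free_frame) set" where
  "formal_relations R = (\<lambda>(\<A>, \<B>). (join_meet gen \<A>, join_meet gen \<B>)) ` R"

definition semilattice_presentation ::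
    "('g::bounded_semilattice_sup_bot fset set \<times> 'g fset set) set
      \<Rightarrow> ('g free_frame \<times> 'g free_frame) set" where
  "semilattice_presentation R = join_relations \<union> formal_relations R"

definition directed_representation ::
    "('g \<Rightarrow> 'x::frame) \<Rightarrow> 'x \<Rightarrow> 'g fset set \<Rightarrow> bool" where
  "directed_representation \<iota> x \<T> \<longleftrightarrow> directed (\<le>) (meet_of \<iota> ` \<T>) \<and> x = join_meet \<iota> \<T>"

section \<open>Presentation of a proper quotient\<close>

text \<open>The generator \<open>\<box>g\<close> is the generator indexed by \<open>g\<close> of the free frame on the underlying set of
  \<open>G\<close>. Here \<open>\<rho> t\<close> is the specified representation of \<open>q\<^sup>*q\<^sub>*(t)\<close>.\<close>

abbreviation (input) box :: "'g \<Rightarrow> 'g free_frame" where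
  "box \<equiv> gen"

definition box_relations ::
    "('g::bounded_semilattice_sup_bot \<Rightarrow> 'g fset set) \<Rightarrow> ('g free_frame \<times> 'g free_frame) set" where
  "box_relations \<rho> = eqs ({(box bot, bot)} \<union>
     {(sup (box s) (box t), join_meet (\<lambda>b. box (sup s b)) (\<rho> t)) | s t. True})"

text \<open>Order relations \<open>\<box>s \<le> \<box>t\<close> for \<open>s \<le> t\<close>. They are what makes the joins in \<open>R\<close> and in
  \<^const>\<open>box_relations\<close>, read in terms of the \<open>\<box>g\<close>, directed, and for arbitrary \<open>\<rho>\<close> they do not
  follow from \<open>R\<close> and \<^term>\<open>box_relations \<rho>\<close>. For instance, let \<open>G\<close> be the natural numbers with
  maximum as join, let \<open>R\<close> consist of \<open>max (2k) c \<le> c\<close> for all \<open>k\<close> and \<open>c\<close>, and let \<open>q\<close> be the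
  identity. All generators are \<open>0\<close> in \<open>OX\<close>, so \<open>OX\<close> has two elements, and one may represent \<open>t\<close> as
  \<open>0\<close> if \<open>t\<close> is even and as the directed join of all odd numbers if \<open>t\<close> is odd. Sending \<open>\<box>g\<close> to
  true iff \<open>g\<close> is odd validates \<open>R\<close> and the box relations, so without the order relations the
  presented frame has more than two elements. For suitable \<open>\<rho>\<close>, e.g. with \<open>\<rho> t\<close> the set of all \<open>A\<close>
  whose meet lies below \<open>q\<^sup>*q\<^sub>*(t)\<close>, the order relations are redundant.\<close>

definition order_relations ::
    "('g::bounded_semilattice_sup_bot free_frame \<times> 'g free_frame) set" where
  "order_relations = {(box s, box t) | s t. s \<le> t}"

end

theory Submission
  imports Defs
begin

text \<open>The valuation \<open>\<box>g \<mapsto> q\<^sub>*(g)\<close> validates the relations because \<open>q\<^sub>*\<close> preserves finite meets and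
  directed joins and \<open>q\<^sub>*(s) \<or> q\<^sub>*(t) = q\<^sub>*(s \<or> q\<^sup>*q\<^sub>*(t))\<close>. It is onto since \<open>q\<^sub>*\<close> is and every element of
  \<open>OX\<close> is a directed join of finite meets of generators. For injectivity one needs an inverse. The
  coverage theorem for presentations of preframe type extends \<open>\<box>\<close> to a preframe homomorphism from
  \<open>OX\<close> to the presented frame. Preceded by \<open>q\<^sup>*\<close> it becomes a frame homomorphism: the box relations
  extend from generators to \<open>\<box>a \<or> \<box>b = \<box>(a \<or> q\<^sup>*q\<^sub>*(b))\<close> for all \<open>a\<close> and \<open>b\<close>, and \<open>q\<^sup>*q\<^sub>*\<close> fixes the
  image of \<open>q\<^sup>*\<close>. With \<open>\<rho> t\<close> the
  family of all \<open>A\<close> whose meet lies below \<open>q\<^sup>*q\<^sub>*(t)\<close>, the order relations are the instances \<open>s = 0\<close> of the box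
  relations, because \<open>\<rho>\<close> is then monotone.\<close>

section \<open>Distributive laws, frame homomorphisms and joins of finite meets\<close>

lemma frame_inf_sup: "inf a (sup b c) = sup (inf a b) (inf a (c::'a::frame))"
  using inf_Sup_frame[of a "{b, c}"] by simp

lemma frame_sup_inf: "sup a (inf b c) = inf (sup a b) (sup a (c::'a::frame))"
proof -
  have "inf (sup a b) (sup a c) = sup (inf (sup a b) a) (inf (sup a b) c)"
    by (rule frame_inf_sup)
  also have "\<dots> = sup a (sup (inf c a) (inf c b))"
    by (simp add: inf.commute[of _ c] frame_inf_sup inf.absorb2)
  also have "\<dots> = sup a (inf b c)"
    by (simp add: sup.assoc[symmetric] sup.absorb1 inf.commute)
  finally show ?thesis by simp
qed

text \<open>Two-valued valuations are used later to refute inequalities between formal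
  meets.\<close>

instance bool :: frame
  by standard auto

lemma frame_hom_Sup: "frame_hom h \<Longrightarrow> h (Sup S) = (SUP u\<in>S. h u)"
  by (simp add: frame_hom_def)

lemma frame_hom_inf: "frame_hom h \<Longrightarrow> h (inf u v) = inf (h u) (h v)"
  by (simp add: frame_hom_def)

lemma frame_hom_sup: "frame_hom h \<Longrightarrow> h (sup u v) = sup (h u) (h v)"
  using frame_hom_Sup[of h "{u, v}"] by simp

lemma frame_hom_bot: "frame_hom h \<Longrightarrow> h bot = bot"
  using frame_hom_Sup[of h "{}"] by simp

lemma frame_hom_mono: "frame_hom h \<Longrightarrow> u \<le> v \<Longrightarrow> h u \<le> h v"
  by (metis frame_hom_inf inf.absorb_iff1)

lemma frame_hom_join_meet: "frame_hom h \<Longrightarrow> h (join_meet f \<A>) = join_meet (h \<circ> f) \<A>"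
  by (simp add: join_meet_def frame_hom_Sup image_image frame_hom_meet_of)

lemma free_ext_unique: "frame_hom h \<Longrightarrow> (\<And>g. h (gen g) = f g) \<Longrightarrow> h = free_ext f"
  using free_frame_universal[of f] frame_hom_free_ext[of f] free_ext_gen[of f] by blast

lemma free_ext_meet_of: "free_ext f (meet_of gen A) = meet_of f A"
  by (simp add: frame_hom_meet_of[OF frame_hom_free_ext] comp_def free_ext_gen)

lemma free_ext_join_meet: "free_ext f (join_meet (\<lambda>g. gen (k g)) \<A>) = join_meet (\<lambda>g. f (k g)) \<A>"
  by (simp add: frame_hom_join_meet[OF frame_hom_free_ext] comp_def free_ext_gen)

lemma meet_of_fempty [simp]: "meet_of f {||} = top"
  by (simp add: meet_of_def)

lemma meet_of_finsert [simp]: "meet_of f (finsert a A) = inf (f a) (meet_of f A)"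
  by (simp add: meet_of_def)

lemma meet_of_lower: "a |\<in>| A \<Longrightarrow> meet_of f A \<le> f a"
  by (simp add: meet_of_def INF_lower)

lemma meet_of_fimage: "meet_of f (g |`| A) = meet_of (\<lambda>a. f (g a)) A"
  by (simp add: meet_of_def image_image)

lemma join_meet_upper: "A \<in> \<A> \<Longrightarrow> meet_of f A \<le> join_meet f \<A>"
  by (simp add: join_meet_def SUP_upper)

lemma join_meet_least: "(\<And>A. A \<in> \<A> \<Longrightarrow> meet_of f A \<le> u) \<Longrightarrow> join_meet f \<A> \<le> u"
  by (simp add: join_meet_def SUP_least)

lemma sup_meet_of: "sup u (meet_of f A) = meet_of (\<lambda>a. sup u (f a)) A"
  by (induction A) (simp_all add: frame_sup_inf)

lemma meet_of_sup: "meet_of (\<lambda>a. sup (f a) u) A = sup (meet_of f A) u"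
  by (simp add: sup.commute[of _ u] sup_meet_of)

text \<open>For an empty family the left side would be \<open>u\<close> and the right side bottom.
  Otherwise \<open>u\<close> distributes over the outer join, and over each finite meet by the dual
  distributive law.\<close>

lemma sup_join_meet:
  assumes "\<A> \<noteq> {}"
  shows "sup u (join_meet f \<A>) = join_meet (\<lambda>a. sup u (f a)) \<A>"
proof -
  have "sup u (join_meet f \<A>) = (SUP A\<in>\<A>. sup u (meet_of f A))"
    unfolding join_meet_def
    using assms by (intro antisym le_supI SUP_least SUP_mono) (auto intro: SUP_upper2 SUP_upper le_supI2)
  then show ?thesis by (simp add: join_meet_def sup_meet_of)
qed

lemma join_meet_image: "join_meet f ((|`|) g ` \<A>) = join_meet (\<lambda>a. f (g a)) \<A>"
  by (simp add: join_meet_def image_image meet_of_fimage)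

lemma inf_join_meet: "inf u (join_meet f \<A>) = (SUP A\<in>\<A>. inf u (meet_of f A))"
  by (simp add: join_meet_def inf_Sup_frame image_image)

section \<open>The preorder of a presentation\<close>

lemma cls_inf_cong:
  assumes "cls Q u = cls Q u'" "cls Q v = cls Q v'"
  shows "cls Q (inf u v) = cls Q (inf u' v')"
  using assms frame_congruence_generated[of Q] by (simp add: cls_eq_iff frame_congruence_def)

lemma cls_le_of_le: "u \<le> v \<Longrightarrow> cls_le Q u v"
  by (simp add: cls_le_def inf.absorb1)

lemma cls_le_trans [trans]:
  assumes "cls_le Q u v" "cls_le Q v w"
  shows "cls_le Q u w"
proof -
  have "cls Q (inf u w) = cls Q (inf (inf u v) w)"
    using assms(1) by (intro cls_inf_cong) (simp_all add: cls_le_def)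
  also have "\<dots> = cls Q (inf u v)"
    using assms(2) by (subst inf.assoc, intro cls_inf_cong) (simp_all add: cls_le_def)
  finally show ?thesis using assms(1) by (simp add: cls_le_def)
qed

lemma cls_le_le_trans [trans]: "cls_le Q u v \<Longrightarrow> v \<le> w \<Longrightarrow> cls_le Q u w"
  by (blast intro: cls_le_trans cls_le_of_le)

lemma le_cls_le_trans [trans]: "u \<le> v \<Longrightarrow> cls_le Q v w \<Longrightarrow> cls_le Q u w"
  by (blast intro: cls_le_trans cls_le_of_le)

lemma cls_le_antisym: "cls_le Q u v \<Longrightarrow> cls_le Q v u \<Longrightarrow> cls Q u = cls Q v"
  by (simp add: cls_le_def inf.commute)

lemma cls_le_inf:
  assumes "cls_le Q w u" "cls_le Q w v"
  shows "cls_le Q w (inf u v)"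
proof -
  have "cls Q (inf (inf w u) v) = cls Q (inf w v)"
    using assms(1) by (intro cls_inf_cong) (simp_all add: cls_le_def)
  with assms(2) show ?thesis by (simp add: cls_le_def inf.assoc)
qed

lemma cls_le_inf_mono: "cls_le Q u u' \<Longrightarrow> cls_le Q v v' \<Longrightarrow> cls_le Q (inf u v) (inf u' v')"
  by (blast intro: cls_le_inf le_cls_le_trans inf.cobounded1 inf.cobounded2)

text \<open>Congruences respect joins of arbitrary sets of pairs. For the pairs
  \<open>(inf (f i) v, f i)\<close> frame distributivity then pulls \<open>v\<close> out of the
  join.\<close>

lemma cls_le_SUP:
  assumes "\<And>i. i \<in> I \<Longrightarrow> cls_le Q (f i) v"
  shows "cls_le Q (SUP i\<in>I. f i) v"
proof -
  let ?S = "(\<lambda>i. (inf (f i) v, f i)) ` I"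
  have "?S \<subseteq> generated_cong Q"
    using assms by (auto simp: cls_le_def cls_eq_iff)
  then have "(Sup (fst ` ?S), Sup (snd ` ?S)) \<in> generated_cong Q"
    using frame_congruence_generated[of Q] unfolding frame_congruence_def by blast
  then show ?thesis
    by (simp add: cls_le_def cls_eq_iff image_image inf.commute[of _ v] inf_Sup_frame)
qed

lemma cls_le_sup: "cls_le Q u w \<Longrightarrow> cls_le Q v w \<Longrightarrow> cls_le Q (sup u v) w"
  using cls_le_SUP[of "{u, v}" Q "\<lambda>u. u" w] by auto

lemma cls_le_join_meet:
  "(\<And>A. A \<in> \<A> \<Longrightarrow> cls_le Q (meet_of f A) v) \<Longrightarrow> cls_le Q (join_meet f \<A>) v"
  unfolding join_meet_def by (rule cls_le_SUP)

lemma cls_le_meet_of: "(\<And>a. a |\<in>| A \<Longrightarrow> cls_le Q u (f a)) \<Longrightarrow> cls_le Q u (meet_of f A)"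
  by (induction A) (simp_all add: cls_le_inf cls_le_of_le)

text \<open>Soundness of a presentation: the generated congruence lies in the kernel of every
  homomorphism that validates \<open>Q\<close>.\<close>

lemma free_ext_le_of_cls_le:
  assumes "\<forall>(u, v)\<in>Q. free_ext f u \<le> free_ext f v" and "cls_le Q u v"
  shows "free_ext f u \<le> free_ext f v"
  using generated_cong_kernel[OF frame_hom_free_ext assms(1), of "inf u v" u] assms(2)
  by (simp add: cls_le_def cls_eq_iff frame_hom_inf[OF frame_hom_free_ext] inf.absorb_iff1)

text \<open>An element \<open>p\<close> as below determines the largest congruence for which the elements below \<open>p\<close>
  form a union of classes.\<close>

lemma saturated_cls_le:
  assumes sat: "\<And>u v w. (u, v) \<in> Q \<Longrightarrow> inf w v \<le> p \<Longrightarrow> inf w u \<le> p"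
    and "cls_le Q u v" and "v \<le> p"
  shows "u \<le> p"
proof -
  \<comment> \<open>Testing in every context \<open>w\<close> gives compatibility with meets;
    compatibility with joins is frame distributivity. The context \<open>top\<close> recovers the
    condition on \<open>p\<close> itself.\<close>
  define \<theta> where "\<theta> = {(u, v). \<forall>w. inf w u \<le> p \<longleftrightarrow> inf w v \<le> p}"
  have "frame_congruence \<theta>"
    unfolding frame_congruence_def
  proof (intro conjI allI impI)
    show "equiv UNIV \<theta>"
      by (auto simp: \<theta>_def equiv_def refl_on_def sym_def trans_def)
    show "(inf u v, inf u' v') \<in> \<theta>" if uu: "(u, u') \<in> \<theta>" and vv: "(v, v') \<in> \<theta>" for u u' v v'
    proof -
      have "inf w (inf u v) \<le> p \<longleftrightarrow> inf w (inf u' v') \<le> p" for w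
      proof -
        have "inf (inf w u) v \<le> p \<longleftrightarrow> inf (inf w u) v' \<le> p" using vv by (simp add: \<theta>_def)
        moreover have "inf (inf w v') u \<le> p \<longleftrightarrow> inf (inf w v') u' \<le> p" using uu by (simp add: \<theta>_def)
        ultimately show ?thesis by (simp add: ac_simps)
      qed
      then show ?thesis by (simp add: \<theta>_def)
    qed
    show "(Sup (fst ` S), Sup (snd ` S)) \<in> \<theta>" if "S \<subseteq> \<theta>" for S
      using that by (fastforce simp: \<theta>_def inf_Sup_frame image_image SUP_le_iff)
  qed
  moreover have "(inf u v, u) \<in> \<theta>" if "(u, v) \<in> Q" for u v
  proof -
    have "inf w u \<le> p" if "inf w (inf u v) \<le> p" for w
      using sat[OF \<open>(u, v) \<in> Q\<close>, of "inf w u"] that by (simp add: ac_simps)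
    moreover have "inf w (inf u v) \<le> inf w u" for w by (simp add: inf.coboundedI2)
    ultimately show ?thesis unfolding \<theta>_def by (blast intro: order_trans)
  qed
  ultimately have "generated_cong Q \<subseteq> \<theta>"
    unfolding generated_cong_def by (intro Inter_lower) auto
  with assms(2) have "(inf u v, u) \<in> \<theta>" by (auto simp: cls_le_def cls_eq_iff)
  then have "inf top (inf u v) \<le> p \<longleftrightarrow> inf top u \<le> p" unfolding \<theta>_def by blast
  with assms(3) show ?thesis by (simp add: le_infI2)
qed

section \<open>Preframe coverage\<close>

text \<open>Read as formal meets, this is the join of the meets of \<open>A\<close> and
  \<open>D\<close> multiplied out by distributivity. It lets joins of finite meets be handled
  without leaving finite sets of generators.\<close>

definition joins :: "'g::semilattice_sup fset \<Rightarrow> 'g fset \<Rightarrow> 'g fset" where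
  "joins A D = ffUnion ((\<lambda>d. (\<lambda>a. sup a d) |`| A) |`| D)"

lemma fmember_joins: "x |\<in>| joins A D \<longleftrightarrow> (\<exists>a d. a |\<in>| A \<and> d |\<in>| D \<and> x = sup a d)"
  by (auto simp: joins_def ffUnion.rep_eq)

lemma joins_assoc: "joins (joins A B) C = joins A (joins B C)"
  by (rule fset_eqI) (fastforce simp: fmember_joins sup.assoc)

lemma joins_commute: "joins A B = joins B A"
  by (rule fset_eqI) (fastforce simp: fmember_joins sup.commute)

lemma joins_bot: "joins A {|bot|} = (A :: 'g::bounded_semilattice_sup_bot fset)"
  by (rule fset_eqI) (simp add: fmember_joins)

lemma joins_fempty: "joins A {||} = {||}"
  by (simp add: joins_def)

lemma joins_finsert: "joins A (finsert d D) = (\<lambda>a. sup a d) |`| A |\<union>| joins A D"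
  by (simp add: joins_def)

lemma joins_funion: "joins (A |\<union>| B) D = joins A D |\<union>| joins B D"
  by (rule fset_eqI) (auto simp: fmember_joins)

lemma meet_of_joins:
  assumes "\<And>s t. f (sup s t) = sup (f s) (f t)"
  shows "meet_of f (joins A B) = sup (meet_of f A) (meet_of f B)"
proof (induction B)
  case (insert b B)
  have "meet_of f ((\<lambda>a. sup a b) |`| A) = sup (f b) (meet_of f A)"
    by (simp add: meet_of_fimage assms sup_meet_of sup.commute)
  then show ?case
    by (simp add: joins_finsert meet_of_funion insert.IH frame_sup_inf ac_simps)
qed (simp add: joins_fempty)

text \<open>The valuation that is true exactly outside the principal ideal of \<open>b\<close>
  respects finite joins. If no member of \<open>A\<close> were below \<open>b\<close>, it would make
  the meet of \<open>A\<close> true and the meet of \<open>B\<close> false.\<close>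

lemma join_relations_refine:
  assumes "cls_le join_relations (meet_of gen A) (meet_of gen B)" "b |\<in>| B"
  shows "\<exists>a. a |\<in>| A \<and> a \<le> b"
proof -
  let ?f = "\<lambda>g. \<not> g \<le> b"
  have "\<forall>(u, v)\<in>join_relations. free_ext ?f u \<le> free_ext ?f v"
    by (auto simp: join_relations_def eqs_def free_ext_gen frame_hom_sup[OF frame_hom_free_ext]
        frame_hom_bot[OF frame_hom_free_ext])
  then have "free_ext ?f (meet_of gen A) \<le> free_ext ?f (meet_of gen B)"
    using assms(1) by (rule free_ext_le_of_cls_le)
  moreover have "free_ext ?f (meet_of gen C) \<longleftrightarrow> (\<forall>c. c |\<in>| C \<longrightarrow> \<not> c \<le> b)" for C
    by (simp add: frame_hom_meet_of[OF frame_hom_free_ext] comp_def free_ext_gen)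
       (simp add: meet_of_def Ball_def)
  ultimately show ?thesis using assms(2) by (metis le_boolE order_refl)
qed

text \<open>Combined with \<open>join_relations_refine\<close>, this carries the formal order on
  finite meets over to any \<open>Q\<close> with monotone generators.\<close>

lemma cls_le_meet_of_refine:
  assumes "\<And>s t. s \<le> t \<Longrightarrow> cls_le Q (gen s) (gen t)"
    and "\<And>b. b |\<in>| B \<Longrightarrow> \<exists>a. a |\<in>| A \<and> a \<le> b"
  shows "cls_le Q (meet_of gen A) (meet_of gen B)"
proof (rule cls_le_meet_of)
  fix b assume "b |\<in>| B"
  then obtain a where "a |\<in>| A" "a \<le> b" using assms(2) by blast
  then show "cls_le Q (meet_of gen A) (gen b)"
    by (intro le_cls_le_trans[OF meet_of_lower[of a]] assms(1))
qed

text \<open>Stability of \<open>R\<close> under shifting by one generator is extended to a finite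
  meet \<open>D\<close> by induction. Inserting \<open>d\<close> meets the bound for
  \<open>D\<close> with a shifted relation, and formal directedness merges the two resulting
  indices.\<close>

lemma cls_le_shift_joins:
  assumes R: "preframe_type R"
    and mono: "\<And>s t. s \<le> t \<Longrightarrow> cls_le Q (gen s) (gen t)"
    and RQ: "\<And>\<A> \<B>. (\<A>, \<B>) \<in> R \<Longrightarrow> cls_le Q (join_meet gen \<A>) (join_meet gen \<B>)"
    and AB: "(\<A>, \<B>) \<in> R" and A: "A \<in> \<A>"
  shows "cls_le Q (meet_of gen (joins A D)) (join_meet gen ((\<lambda>B. joins B D) ` \<B>))"
proof (induction D)
  case empty
  \<comment> \<open>For empty \<open>D\<close> both sides are to be top, and a join of copies of top
    is top only over a nonempty family.\<close>
  have "\<B> \<noteq> {}" using R AB by (auto simp: preframe_type_def formally_directed_def directed_def)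
  then show ?case by (simp add: joins_fempty join_meet_def image_constant_conv cls_le_of_le)
next
  case (insert d D)
  let ?s = "\<lambda>B. (\<lambda>b. sup b d) |`| B"
  have "meet_of gen (?s A) \<le> join_meet gen (shift d \<A>)"
    using A by (auto simp: shift_def intro: join_meet_upper)
  also have "cls_le Q \<dots> (join_meet gen (shift d \<B>))"
    using R AB by (intro RQ) (auto simp: preframe_type_def)
  finally have "cls_le Q (meet_of gen (joins A (finsert d D)))
      (inf (join_meet gen (shift d \<B>)) (join_meet gen ((\<lambda>B. joins B D) ` \<B>)))"
    using insert by (simp add: joins_finsert meet_of_funion cls_le_inf_mono)
  also have "cls_le Q \<dots> (join_meet gen ((\<lambda>B. joins B (finsert d D)) ` \<B>))"
  proof -
    have *: "cls_le Q (inf (meet_of gen (joins B D)) (meet_of gen (?s B')))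
        (join_meet gen ((\<lambda>B. joins B (finsert d D)) ` \<B>))" if BB: "B \<in> \<B>" "B' \<in> \<B>" for B B'
    proof -
      \<comment> \<open>Directedness is available only modulo \<open>join_relations\<close>.
        Refinement turns it into a condition on generators that survives \<open>joins\<close> and
        shifting and is meaningful for \<open>Q\<close>.\<close>
      obtain C where C: "C \<in> \<B>" "cls_le join_relations (meet_of gen B) (meet_of gen C)"
          "cls_le join_relations (meet_of gen B') (meet_of gen C)"
        using R AB BB by (fastforce simp: preframe_type_def formally_directed_def directed_def)
      have ref: "\<exists>b. b |\<in>| B \<and> b \<le> c" "\<exists>b. b |\<in>| B' \<and> b \<le> c" if "c |\<in>| C" for c
        using C that join_relations_refine by blast+
      have "\<exists>b. b |\<in>| joins B D \<and> b \<le> x" if "x |\<in>| joins C D" for x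
        using that ref(1) by (metis fmember_joins order_refl sup_mono)
      moreover have "\<exists>b. b |\<in>| ?s B' \<and> b \<le> x" if "x |\<in>| ?s C" for x
        using that ref(2) by (metis (no_types, lifting) fimageE fimageI order_refl sup_mono)
      ultimately have "cls_le Q (inf (meet_of gen (joins B D)) (meet_of gen (?s B')))
          (inf (meet_of gen (joins C D)) (meet_of gen (?s C)))"
        by (intro cls_le_inf_mono cls_le_meet_of_refine mono)
      also have "\<dots> = meet_of gen (joins C (finsert d D))"
        by (simp add: joins_finsert meet_of_funion inf.commute)
      also have "\<dots> \<le> join_meet gen ((\<lambda>B. joins B (finsert d D)) ` \<B>)"
        using C(1) by (intro join_meet_upper) simp
      finally show ?thesis .
    qed
    have "cls_le Q (inf (join_meet gen (shift d \<B>)) (meet_of gen (joins B D)))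
        (join_meet gen ((\<lambda>B. joins B (finsert d D)) ` \<B>))" if "B \<in> \<B>" for B
      unfolding inf.commute[of _ "meet_of gen (joins B D)"] inf_join_meet shift_def
      using * that by (auto intro!: cls_le_SUP)
    then show ?thesis
      unfolding inf_join_meet by (auto intro!: cls_le_SUP)
  qed
  finally show ?case .
qed

lemma joins_refine:
  fixes A :: "'g::semilattice_sup fset"
  assumes "\<And>a. a |\<in>| A \<Longrightarrow> \<exists>b. b |\<in>| B \<and> b \<le> a" and "x |\<in>| joins A D"
  shows "\<exists>b. b |\<in>| joins B D \<and> b \<le> x"
  using assms by (metis fmember_joins order_refl sup_mono)

lemma meet_of_gen_le_iff: "meet_of gen A \<le> u \<longleftrightarrow> A \<in> Rep_free_frame u"
  using Rep_free_frame[of u] by (auto simp: less_eq_free_frame.rep_eq Rep_meet_of_gen)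

text \<open>In the free frame a finite meet of generators is a principal upset, hence completely
  join-prime.\<close>

lemma meet_of_gen_le_join_meet_iff:
  "meet_of gen A \<le> join_meet gen \<A> \<longleftrightarrow> (\<exists>B\<in>\<A>. B |\<subseteq>| A)"
  by (auto simp: meet_of_gen_le_iff join_meet_def Sup_free_frame.rep_eq Rep_meet_of_gen)

text \<open>Finite meets of generators are join-dense, so contexts need only be tested on
  them.\<close>

lemma inf_free_frame_le_iff: "inf w u \<le> p \<longleftrightarrow> (\<forall>C. meet_of gen C \<le> w \<longrightarrow> inf (meet_of gen C) u \<le> p)"
proof (intro iffI allI impI)
  assume "\<forall>C. meet_of gen C \<le> w \<longrightarrow> inf (meet_of gen C) u \<le> p"
  then have "inf u (join_meet gen (Rep_free_frame w)) \<le> p"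
    by (auto simp: inf_join_meet inf.commute[of u] meet_of_gen_le_iff intro!: SUP_least)
  then show "inf w u \<le> p"
    by (simp add: free_frame_expand[symmetric] inf.commute)
qed (meson inf_mono order_refl order_trans)

text \<open>Starting from a family \<open>U\<close> closed under \<^const>\<open>joins\<close>, pass to the double orthogonal \<open>W\<close> for the
  relation ``\<open>joins A D\<close> lies below the join of \<open>U\<close>''. Stability of \<open>R\<close> under \<^const>\<open>shift\<close> makes \<open>W\<close>
  closed under \<open>R\<close>, so that it bounds everything the presentation puts below \<open>U\<close>.\<close>

theorem preframe_coverage:
  assumes R: "preframe_type R"
    and mono: "\<And>s t. s \<le> t \<Longrightarrow> cls_le Q (gen s) (gen t)"
    and RQ: "\<And>\<A> \<B>. (\<A>, \<B>) \<in> R \<Longrightarrow> cls_le Q (join_meet gen \<A>) (join_meet gen \<B>)"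
    and U: "U \<noteq> {}" "\<And>A B. A \<in> U \<Longrightarrow> B \<in> U \<Longrightarrow> joins A B \<in> U"
    and le: "cls_le (semilattice_presentation R) (meet_of gen A) (join_meet gen U)"
  shows "cls_le Q (meet_of gen A) (join_meet gen U)"
proof -
  let ?P = "\<lambda>A. cls_le Q (meet_of gen A) (join_meet gen U)"
  define V where "V = {D. \<forall>A\<in>U. ?P (joins A D)}"
  define W where "W = {A. \<forall>D\<in>V. ?P (joins A D)}"
  have P: "?P A" if "?P B" "\<And>b. b |\<in>| B \<Longrightarrow> \<exists>a. a |\<in>| A \<and> a \<le> b" for A B
    using cls_le_meet_of_refine[OF mono that(2)] that(1) by (blast intro: cls_le_trans)
  have PU: "?P A" if "A \<in> U" for A
    using that by (intro cls_le_of_le join_meet_upper)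
  have W_refine: "A \<in> W" if "B \<in> W" "\<And>b. b |\<in>| B \<Longrightarrow> \<exists>a. a |\<in>| A \<and> a \<le> b" for A B
    using that(1) unfolding W_def by (blast intro: P joins_refine[OF that(2)])
  have UW: "U \<subseteq> W" by (auto simp: W_def V_def)
  have W_joins: "joins A B \<in> W" if A: "A \<in> W" and B: "B \<in> W" for A B
  proof -
    \<comment> \<open>A factor from \<open>U\<close> moves past \<open>B\<close> by associativity
      and commutativity, and joining it to \<open>D\<close> stays in \<open>V\<close> because
      \<open>U\<close> is closed under \<open>joins\<close>.\<close>
    have "joins B D \<in> V" if D: "D \<in> V" for D
    proof -
      have "joins C D \<in> V" if "C \<in> U" for C
        using D U(2) that by (auto simp: V_def joins_assoc[symmetric])
      then have "?P (joins B (joins C D))" if "C \<in> U" for C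
        using B that by (auto simp: W_def)
      moreover have "joins B (joins C D) = joins C (joins B D)" for C
        by (metis joins_assoc joins_commute)
      ultimately show ?thesis by (auto simp: V_def)
    qed
    then show ?thesis using A by (auto simp: W_def joins_assoc)
  qed
  have bot_V: "{|bot|} \<in> V" by (auto simp: V_def joins_bot PU)
  have bot_W: "{|bot|} \<in> W"
  proof -
    \<comment> \<open>Since \<open>{|bot|}\<close> is neutral, the meet of \<open>D\<close> has to
      be bounded; it lies below that of \<open>joins B D\<close>, which membership in
      \<open>V\<close> controls once \<open>U\<close> has a member \<open>B\<close>.\<close>
    obtain B where "B \<in> U" using U(1) by blast
    have "?P (joins {|bot|} D)" if D: "D \<in> V" for D
    proof (rule P)
      show "?P (joins B D)" using D \<open>B \<in> U\<close> by (simp add: V_def)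
      show "\<exists>d. d |\<in>| joins {|bot|} D \<and> d \<le> x" if "x |\<in>| joins B D" for x
        using that by (auto simp: fmember_joins)
    qed
    then show ?thesis by (simp add: W_def)
  qed
  define p where "p = join_meet gen W"
  have le_p: "meet_of gen A \<le> p \<longleftrightarrow> A \<in> W" for A
    unfolding p_def meet_of_gen_le_join_meet_iff by (blast intro: W_refine)
  have sat: "inf (meet_of gen C) u \<le> p"
    if uv: "(u, v) \<in> semilattice_presentation R" and v: "inf (meet_of gen C) v \<le> p" for u v C
  proof -
    have inf_gen: "inf (meet_of gen C) (gen s) \<le> p \<longleftrightarrow> finsert s C \<in> W" for s
      by (simp add: le_p[symmetric] inf.commute)
    have inf_sup: "inf (meet_of gen C) (sup (gen s) (gen t)) \<le> p
        \<longleftrightarrow> finsert s C \<in> W \<and> finsert t C \<in> W" for s t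
      by (simp add: frame_inf_sup inf_gen)
    have inf_join: "inf (meet_of gen C) (join_meet gen \<A>) \<le> p \<longleftrightarrow> (\<forall>A\<in>\<A>. C |\<union>| A \<in> W)" for \<A>
      by (simp add: inf_join_meet SUP_le_iff meet_of_funion[symmetric] le_p)
    consider "(u, v) \<in> join_relations" | "(u, v) \<in> formal_relations R"
      using uv by (auto simp: semilattice_presentation_def)
    then show ?thesis
    proof cases
      case 1
      then consider "u = gen bot" | "u = bot" | s t where "u = gen (sup s t)" "v = sup (gen s) (gen t)"
        | s t where "v = gen (sup s t)" "u = sup (gen s) (gen t)"
        by (auto simp: join_relations_def eqs_def)
      then show ?thesis
      proof cases
        case 1
        then show ?thesis using bot_W by (auto simp: inf_gen intro: W_refine)
      next
        case 2
        then show ?thesis by simp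
      next
        case (3 s t)
        \<comment> \<open>Every element of this set is \<open>sup s t\<close> or lies above a member
          of \<open>C\<close>, so \<open>W_refine\<close> passes to
          \<open>finsert (sup s t) C\<close>.\<close>
        then have "joins (finsert s C) (finsert t C) \<in> W"
          using v by (simp add: inf_sup W_joins)
        then have "finsert (sup s t) C \<in> W"
          by (rule W_refine) (auto simp: fmember_joins le_supI1 le_supI2)
        then show ?thesis by (simp add: 3 inf_gen)
      next
        case (4 s t)
        then have "finsert (sup s t) C \<in> W" using v by (simp add: inf_gen)
        then have "finsert s C \<in> W" "finsert t C \<in> W"
          by (auto elim!: W_refine)
        then show ?thesis by (simp add: 4 inf_sup)
      qed
    next
      case 2
      then obtain \<A> \<B> where AB: "(\<A>, \<B>) \<in> R" and u: "u = join_meet gen \<A>"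
          and v': "v = join_meet gen \<B>"
        by (auto simp: formal_relations_def)
      have "?P (joins (C |\<union>| A) D)" if A: "A \<in> \<A>" and D: "D \<in> V" for A D
      proof -
        \<comment> \<open>The context \<open>C\<close> is split off, the stabilised relation
          replaces \<open>A\<close> by the members of \<open>\<B>\<close>, and each
          \<open>C |\<union>| B\<close> is already in \<open>W\<close>.\<close>
        have "cls_le Q (meet_of gen (joins (C |\<union>| A) D))
            (inf (meet_of gen (joins C D)) (join_meet gen ((\<lambda>B. joins B D) ` \<B>)))"
          unfolding joins_funion meet_of_funion
          by (intro cls_le_inf_mono cls_le_of_le order_refl cls_le_shift_joins[OF R mono RQ AB A])
        also have "\<dots> = (SUP B\<in>\<B>. meet_of gen (joins (C |\<union>| B) D))"
          by (simp add: inf_join_meet joins_funion meet_of_funion image_image)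
        also have "cls_le Q \<dots> (join_meet gen U)"
          using v D by (intro cls_le_SUP) (auto simp: v' inf_join W_def)
        finally show ?thesis .
      qed
      then show ?thesis by (auto simp: u inf_join W_def)
    qed
  qed
  have "meet_of gen A \<le> p"
  proof (rule saturated_cls_le[OF _ le])
    show "join_meet gen U \<le> p"
      using UW by (auto simp: le_p intro!: join_meet_least)
    show "inf w u \<le> p" if "(u, v) \<in> semilattice_presentation R" "inf w v \<le> p" for u v w
      using that(2) sat[OF that(1)] by (simp add: inf_free_frame_le_iff[of w])
  qed
  \<comment> \<open>Testing membership in \<open>W\<close> against the neutral element removes the
    auxiliary factor.\<close>
  then have "?P (joins A {|bot|})" using bot_V by (simp add: le_p W_def)
  then show ?thesis by (simp add: joins_bot)
qed

section \<open>Proper quotients\<close>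

lemma directed_image:
  assumes "directed (\<le>) D" "\<And>x y. x \<le> y \<Longrightarrow> f x \<le> f y"
  shows "directed (\<le>) (f ` D)"
  using assms by (fastforce simp: directed_def)

lemma right_adjoint_mono: "a \<le> b \<Longrightarrow> right_adjoint q a \<le> right_adjoint q b"
  unfolding right_adjoint_def by (auto intro!: Sup_subset_mono)

lemma right_adjoint_counit: "frame_hom q \<Longrightarrow> q (right_adjoint q a) \<le> a"
  by (simp add: right_adjoint_iff)

lemma right_adjoint_inf:
  assumes "frame_hom q"
  shows "right_adjoint q (inf a b) = inf (right_adjoint q a) (right_adjoint q b)"
proof (rule antisym)
  show "inf (right_adjoint q a) (right_adjoint q b) \<le> right_adjoint q (inf a b)"
    by (simp add: right_adjoint_iff[OF assms, symmetric] frame_hom_inf[OF assms])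
       (simp add: right_adjoint_counit[OF assms] le_infI1 le_infI2)
qed (simp add: right_adjoint_mono)

lemma right_adjoint_top: "frame_hom q \<Longrightarrow> right_adjoint q top = top"
  by (simp add: right_adjoint_iff[symmetric] top_unique[symmetric])

lemma right_adjoint_meet_of:
  "frame_hom q \<Longrightarrow> right_adjoint q (meet_of f A) = meet_of (\<lambda>a. right_adjoint q (f a)) A"
  by (induction A) (simp_all add: right_adjoint_top right_adjoint_inf)

text \<open>Finite meets are preserved by every right adjoint, directed joins by properness.\<close>

lemma right_adjoint_join_meet:
  assumes "proper_map q" "directed (\<le>) (meet_of f ` \<A>)"
  shows "right_adjoint q (join_meet f \<A>) = join_meet (\<lambda>a. right_adjoint q (f a)) \<A>"
  using assms by (simp add: proper_map_def join_meet_def image_image right_adjoint_meet_of)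

text \<open>The triangle identity gives the equation after applying \<open>q\<close>, and
  injectivity cancels \<open>q\<close>.\<close>

lemma right_adjoint_proper_quotient:
  assumes "proper_quotient q"
  shows "right_adjoint q (q y) = y"
proof -
  have q: "frame_hom q" "inj q" using assms by (auto simp: proper_quotient_def proper_map_def)
  have "q (right_adjoint q (q y)) = q y"
    using right_adjoint_counit[OF q(1)] right_adjoint_iff[OF q(1)] frame_hom_mono[OF q(1)]
    by (metis antisym order_refl)
  then show ?thesis using q(2) by (simp add: inj_eq)
qed

section \<open>The presented frame of X and its generators\<close>

locale presented_quotient =
  fixes R :: "('g::bounded_semilattice_sup_bot fset set \<times> 'g fset set) set"
    and \<phi> :: "'g free_frame set \<Rightarrow> 'x::frame"
    and \<iota> :: "'g \<Rightarrow> 'x"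
    and q :: "'y::frame \<Rightarrow> 'x"
  assumes preframe_type: "preframe_type R"
    and iso: "presentation_iso (semilattice_presentation R) \<phi>"
    and \<iota>: "\<iota> g = \<phi> (cls (semilattice_presentation R) (gen g))"
    and quotient: "proper_quotient q"
begin

abbreviation "r \<equiv> right_adjoint q"

lemma proper: "proper_map q"
  using quotient by (simp add: proper_quotient_def)

lemma hom: "frame_hom q"
  using proper by (simp add: proper_map_def)

lemma r_q [simp]: "r (q y) = y"
  using quotient by (rule right_adjoint_proper_quotient)

lemma free_ext_\<iota>: "free_ext \<iota> u = \<phi> (cls (semilattice_presentation R) u)"
proof -
  have "(\<lambda>u. \<phi> (cls (semilattice_presentation R) u)) = free_ext \<iota>"
    using iso by (intro free_ext_unique) (simp_all add: presentation_iso_def \<iota>)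
  then show ?thesis by (rule fun_cong[symmetric])
qed

text \<open>Injectivity of \<open>\<phi>\<close> makes the presentation complete for the order of
  OX; inequalities checked in OX can thus be fed to the coverage theorem.\<close>

lemma free_ext_\<iota>_le_iff:
  "free_ext \<iota> u \<le> free_ext \<iota> v \<longleftrightarrow> cls_le (semilattice_presentation R) u v"
proof -
  have "inj_on \<phi> (presented_frame (semilattice_presentation R))"
    using iso by (simp add: presentation_iso_def bij_betw_def)
  moreover have "cls (semilattice_presentation R) w \<in> presented_frame (semilattice_presentation R)" for w
    by (auto simp: presented_frame_def cls_def intro: quotientI)
  ultimately have "free_ext \<iota> (inf u v) = free_ext \<iota> u \<longleftrightarrow> cls_le (semilattice_presentation R) u v"
    by (simp add: free_ext_\<iota> inj_on_eq_iff cls_le_def)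
  then show ?thesis
    by (simp add: frame_hom_inf[OF frame_hom_free_ext] inf.absorb_iff1)
qed

lemma free_ext_\<iota>_surj: "\<exists>u. free_ext \<iota> u = x"
proof -
  have "x \<in> \<phi> ` presented_frame (semilattice_presentation R)"
    using iso by (simp add: presentation_iso_def bij_betw_def)
  then show ?thesis
    by (auto simp: presented_frame_def quotient_def cls_def free_ext_\<iota>)
qed

lemma semilattice_presentation_le:
  "(u, v) \<in> semilattice_presentation R \<Longrightarrow> free_ext \<iota> u \<le> free_ext \<iota> v"
  by (simp add: free_ext_\<iota>_le_iff cls_le_relation)

lemma \<iota>_bot: "\<iota> bot = bot"
  using semilattice_presentation_le[of "gen bot" bot]
  by (simp add: semilattice_presentation_def join_relations_def eqs_def free_ext_gen
      frame_hom_bot[OF frame_hom_free_ext] bot_unique)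

lemma \<iota>_sup: "\<iota> (sup s t) = sup (\<iota> s) (\<iota> t)"
proof -
  have "free_ext \<iota> (gen (sup s t)) = free_ext \<iota> (sup (gen s) (gen t))"
    by (intro antisym semilattice_presentation_le)
       (auto simp: semilattice_presentation_def join_relations_def eqs_def)
  then show ?thesis
    by (simp add: free_ext_gen frame_hom_sup[OF frame_hom_free_ext])
qed

lemma \<iota>_mono: "s \<le> t \<Longrightarrow> \<iota> s \<le> \<iota> t"
  by (metis \<iota>_sup le_iff_sup)

text \<open>The largest family of finite meets with join \<open>x\<close>. It is closed under
  \<open>joins\<close> and monotone in \<open>x\<close>.\<close>

definition basis :: "'x \<Rightarrow> 'g fset set" where
  "basis x = {A. meet_of \<iota> A \<le> x}"

lemma join_meet_basis: "join_meet \<iota> (basis x) = x"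
proof (rule antisym)
  obtain u where u: "x = free_ext \<iota> u" using free_ext_\<iota>_surj by metis
  have "Rep_free_frame u \<subseteq> basis x"
    by (auto simp: u basis_def free_ext_def intro: join_meet_upper)
  then show "x \<le> join_meet \<iota> (basis x)"
    by (auto simp: u free_ext_def intro!: join_meet_least intro: join_meet_upper)
qed (auto simp: basis_def intro: join_meet_least)

lemma joins_basis: "A \<in> basis x \<Longrightarrow> B \<in> basis x \<Longrightarrow> joins A B \<in> basis x"
  by (simp add: basis_def meet_of_joins \<iota>_sup)

lemma bot_in_basis: "{|bot|} \<in> basis x"
  by (simp add: basis_def \<iota>_bot)

lemma directed_of_joins:
  assumes "\<A> \<noteq> {}" "\<And>A B. A \<in> \<A> \<Longrightarrow> B \<in> \<A> \<Longrightarrow> joins A B \<in> \<A>"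
  shows "directed (\<le>) (meet_of \<iota> ` \<A>)"
proof -
  have "meet_of \<iota> A \<le> meet_of \<iota> (joins A B)" "meet_of \<iota> B \<le> meet_of \<iota> (joins A B)" for A B
    by (simp_all add: meet_of_joins \<iota>_sup)
  then show ?thesis using assms by (auto simp: directed_def) blast
qed

lemma directed_representation_basis: "directed_representation \<iota> x (basis x)"
  using bot_in_basis[of x]
  by (auto simp: directed_representation_def join_meet_basis joins_basis intro!: directed_of_joins)

lemma formally_directed: "formally_directed \<A> \<Longrightarrow> directed (\<le>) (meet_of \<iota> ` \<A>)"
proof -
  have "\<forall>(u, v)\<in>join_relations. free_ext \<iota> u \<le> free_ext \<iota> v"
    by (auto intro: semilattice_presentation_le simp: semilattice_presentation_def)
  then have "meet_of \<iota> A \<le> meet_of \<iota> B" if "cls_le join_relations (meet_of gen A) (meet_of gen B)" for A B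
    using free_ext_le_of_cls_le[OF _ that, of \<iota>] by (simp add: free_ext_meet_of)
  then show "directed (\<le>) (meet_of \<iota> ` \<A>)" if "formally_directed \<A>"
    using that unfolding formally_directed_def directed_def by (simp add: ball_simps bex_simps) meson
qed

end

text \<open>\<open>Q\<close> is kept between two bounds so that one argument serves with the order
  relations and, where these are derivable, without them. The assumption \<open>mono\<close> is all
  it takes from them.\<close>

locale box_presentation = presented_quotient R \<phi> \<iota> q
  for R :: "('g::bounded_semilattice_sup_bot fset set \<times> 'g fset set) set"
    and \<phi> :: "'g free_frame set \<Rightarrow> 'x::frame"
    and \<iota> :: "'g \<Rightarrow> 'x"
    and q :: "'y::frame \<Rightarrow> 'x" +
  fixes \<rho> :: "'g \<Rightarrow> 'g fset set"
    and Q :: "('g free_frame \<times> 'g free_frame) set"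
  assumes \<rho>: "directed_representation \<iota> (q (r (\<iota> t))) (\<rho> t)"
    and Q_upper: "Q \<subseteq> formal_relations R \<union> order_relations \<union> box_relations \<rho>"
    and Q_lower: "formal_relations R \<union> box_relations \<rho> \<subseteq> Q"
    and mono: "s \<le> t \<Longrightarrow> cls_le Q (gen s) (gen t)"
begin

section \<open>The valuation of the boxes in the frame of Y\<close>

abbreviation f :: "'g \<Rightarrow> 'y" where "f g \<equiv> r (\<iota> g)"

lemma sup_\<rho>:
  shows "sup (\<iota> s) (q (f t)) = join_meet (\<lambda>b. \<iota> (sup s b)) (\<rho> t)"
    and "directed (\<le>) (meet_of (\<lambda>b. \<iota> (sup s b)) ` \<rho> t)"
proof -
  have \<rho>t: "directed (\<le>) (meet_of \<iota> ` \<rho> t)" "q (f t) = join_meet \<iota> (\<rho> t)"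
    using \<rho>[of t] by (auto simp: directed_representation_def)
  then have "\<rho> t \<noteq> {}" by (auto simp: directed_def)
  then show "sup (\<iota> s) (q (f t)) = join_meet (\<lambda>b. \<iota> (sup s b)) (\<rho> t)"
    by (simp add: \<rho>t(2) sup_join_meet \<iota>_sup)
  have "meet_of (\<lambda>b. \<iota> (sup s b)) ` \<rho> t = sup (\<iota> s) ` (meet_of \<iota> ` \<rho> t)"
    by (simp add: image_image sup_meet_of \<iota>_sup)
  also have "directed (\<le>) \<dots>"
    using \<rho>t(1) by (rule directed_image) (rule sup_mono[OF order_refl])
  finally show "directed (\<le>) (meet_of (\<lambda>b. \<iota> (sup s b)) ` \<rho> t)" .
qed

text \<open>The projection formula of a proper map absorbs \<open>f t\<close> as
  \<open>q (f t)\<close> under \<open>r\<close>. The shifted representation is directed, so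
  \<open>r\<close> then moves inside it.\<close>

lemma sup_f: "sup (f s) (f t) = join_meet (\<lambda>b. f (sup s b)) (\<rho> t)"
proof -
  have "sup (f s) (f t) = r (sup (\<iota> s) (q (f t)))"
    using proper by (simp add: proper_map_def)
  then show ?thesis by (simp add: sup_\<rho> right_adjoint_join_meet[OF proper])
qed

lemma f_bot: "f bot = bot"
  using r_q[of bot] by (simp add: \<iota>_bot frame_hom_bot[OF hom])

lemma validates:
  assumes "(u, v) \<in> Q"
  shows "free_ext f u \<le> free_ext f v"
proof -
  consider "(u, v) \<in> formal_relations R" | "(u, v) \<in> order_relations" | "(u, v) \<in> box_relations \<rho>"
    using assms Q_upper by blast
  then show ?thesis
  proof cases
    case 1
    then obtain \<A> \<B> where AB: "(\<A>, \<B>) \<in> R" "u = join_meet gen \<A>" "v = join_meet gen \<B>"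
      by (auto simp: formal_relations_def)
    have "free_ext \<iota> u \<le> free_ext \<iota> v"
      using 1 by (simp add: semilattice_presentation_le semilattice_presentation_def)
    then have "r (join_meet \<iota> \<A>) \<le> r (join_meet \<iota> \<B>)"
      using free_ext_join_meet[of \<iota> "\<lambda>g. g"] by (simp add: AB right_adjoint_mono)
    moreover have "formally_directed \<A>" "formally_directed \<B>"
      using preframe_type AB(1) by (auto simp: preframe_type_def)
    ultimately show ?thesis
      using free_ext_join_meet[of f "\<lambda>g. g"]
      by (simp add: AB right_adjoint_join_meet[OF proper] formally_directed)
  next
    case 2
    then obtain s t where "s \<le> t" "u = gen s" "v = gen t" by (auto simp: order_relations_def)
    then show ?thesis by (simp add: free_ext_gen right_adjoint_mono \<iota>_mono)
  next
    case 3
    then show ?thesis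
      by (auto simp: box_relations_def eqs_def free_ext_gen f_bot sup_f free_ext_join_meet
          frame_hom_bot[OF frame_hom_free_ext] frame_hom_sup[OF frame_hom_free_ext])
  qed
qed

section \<open>Coverage inside the box presentation\<close>

lemma box_bot_le: "cls_le Q (gen bot) bot"
  by (rule cls_le_relation, rule subsetD[OF Q_lower]) (auto simp: box_relations_def eqs_def)

lemma box_sup_le: "cls_le Q (sup (gen s) (gen t)) (join_meet (\<lambda>b. gen (sup s b)) (\<rho> t))"
  by (rule cls_le_relation, rule subsetD[OF Q_lower]) (auto simp: box_relations_def eqs_def)

lemma box_sup_ge: "cls_le Q (join_meet (\<lambda>b. gen (sup s b)) (\<rho> t)) (sup (gen s) (gen t))"
  by (rule cls_le_relation, rule subsetD[OF Q_lower]) (auto simp: box_relations_def eqs_def)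

lemma coverage:
  assumes "U \<noteq> {}" "\<And>A B. A \<in> U \<Longrightarrow> B \<in> U \<Longrightarrow> joins A B \<in> U" "meet_of \<iota> A \<le> join_meet \<iota> U"
  shows "cls_le Q (meet_of gen A) (join_meet gen U)"
proof (rule preframe_coverage[OF preframe_type mono _ assms(1,2)])
  show "cls_le Q (join_meet gen \<A>) (join_meet gen \<B>)" if "(\<A>, \<B>) \<in> R" for \<A> \<B>
    using that Q_lower by (intro cls_le_relation) (auto simp: formal_relations_def)
  show "cls_le (semilattice_presentation R) (meet_of gen A) (join_meet gen U)"
    using assms(3) free_ext_join_meet[of \<iota> "\<lambda>g. g"]
    by (simp add: free_ext_\<iota>_le_iff[symmetric] free_ext_meet_of)
qed

text \<open>The family consisting of \<open>{|g|}\<close> alone is closed under \<open>joins\<close>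
  by idempotence.\<close>

lemma coverage_gen:
  assumes "meet_of \<iota> A \<le> \<iota> g"
  shows "cls_le Q (meet_of gen A) (gen g)"
proof -
  have "joins {|g|} {|g|} = {|g|}" by (simp add: joins_def)
  then show ?thesis
    using coverage[of "{{|g|}}" A] assms by (simp add: join_meet_def)
qed

text \<open>A family directed in OX need not be closed under \<open>joins\<close>, but the family of
  all formal meets below one of its members is. \<open>coverage_gen\<close>, applied to the
  generators of that member, leads back.\<close>

lemma coverage_directed:
  assumes dir: "directed (\<le>) (meet_of \<iota> ` \<T>)" and le: "meet_of \<iota> A \<le> join_meet \<iota> \<T>"
  shows "cls_le Q (meet_of gen A) (join_meet gen \<T>)"
proof -
  define U where "U = {C. \<exists>B\<in>\<T>. meet_of \<iota> C \<le> meet_of \<iota> B}"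
  have "\<T> \<subseteq> U" by (auto simp: U_def)
  have "cls_le Q (meet_of gen A) (join_meet gen U)"
  proof (rule coverage)
    show "U \<noteq> {}" using \<open>\<T> \<subseteq> U\<close> dir by (auto simp: directed_def)
    show "joins B C \<in> U" if "B \<in> U" "C \<in> U" for B C
    proof -
      obtain B' C' where "B' \<in> \<T>" "C' \<in> \<T>" "meet_of \<iota> B \<le> meet_of \<iota> B'" "meet_of \<iota> C \<le> meet_of \<iota> C'"
        using \<open>B \<in> U\<close> \<open>C \<in> U\<close> unfolding U_def by blast
      moreover from this obtain D where "D \<in> \<T>" "meet_of \<iota> B' \<le> meet_of \<iota> D" "meet_of \<iota> C' \<le> meet_of \<iota> D"
        using dir by (auto simp: directed_def)
      ultimately show ?thesis
        by (auto simp: U_def meet_of_joins \<iota>_sup intro: order_trans)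
    qed
    show "meet_of \<iota> A \<le> join_meet \<iota> U"
      using le \<open>\<T> \<subseteq> U\<close> by (auto simp: join_meet_def intro: order_trans SUP_subset_mono)
  qed
  also have "cls_le Q \<dots> (join_meet gen \<T>)"
  proof (rule cls_le_join_meet)
    fix C assume "C \<in> U"
    then obtain B where B: "B \<in> \<T>" "meet_of \<iota> C \<le> meet_of \<iota> B" by (auto simp: U_def)
    then have "cls_le Q (meet_of gen C) (meet_of gen B)"
      by (intro cls_le_meet_of coverage_gen) (blast intro: order_trans meet_of_lower)
    then show "cls_le Q (meet_of gen C) (join_meet gen \<T>)"
      using B(1) by (blast intro: cls_le_le_trans join_meet_upper)
  qed
  finally show ?thesis .
qed

section \<open>The inverse map and its preservation of meets and joins\<close>

text \<open>Up to the congruence generated by \<open>Q\<close>, this is the inverse of \<^term>\<open>free_ext f\<close>.\<close>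

definition k :: "'y \<Rightarrow> 'g free_frame" where
  "k y = join_meet gen (basis (q y))"

lemma meet_of_gen_le_k: "meet_of \<iota> A \<le> q y \<Longrightarrow> meet_of gen A \<le> k y"
  unfolding k_def by (rule join_meet_upper) (simp add: basis_def)

lemma k_least: "(\<And>A. meet_of \<iota> A \<le> q y \<Longrightarrow> cls_le Q (meet_of gen A) u) \<Longrightarrow> cls_le Q (k y) u"
  unfolding k_def by (rule cls_le_join_meet) (simp add: basis_def)

lemma k_mono:
  assumes "x \<le> y"
  shows "k x \<le> k y"
proof -
  have "basis (q x) \<subseteq> basis (q y)"
    using frame_hom_mono[OF hom assms] by (auto simp: basis_def)
  then show ?thesis by (simp add: k_def join_meet_def SUP_subset_mono)
qed

lemma inf_k_le: "inf (k x) (k y) \<le> k (inf x y)"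
proof -
  have "inf (meet_of gen A) (meet_of gen B) \<le> k (inf x y)"
    if "A \<in> basis (q x)" "B \<in> basis (q y)" for A B
    unfolding meet_of_funion[symmetric] using that
    by (intro meet_of_gen_le_k)
       (auto simp: basis_def meet_of_funion frame_hom_inf[OF hom] intro: le_infI1 le_infI2)
  then have "inf (k y) (meet_of gen A) \<le> k (inf x y)" if "A \<in> basis (q x)" for A
    using that unfolding k_def[of y] inf.commute[of "join_meet _ _"] inf_join_meet
    by (intro SUP_least)
  then show ?thesis
    unfolding k_def[of x] inf.commute[of "join_meet _ _"] inf_join_meet
    by (intro SUP_least) (simp add: inf.commute)
qed

lemma meet_of_k_le: "meet_of (\<lambda>a. k (g a)) A \<le> k (meet_of g A)"
proof (induction A)
  case empty
  have "meet_of gen {||} \<le> k top"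
    using hom by (intro meet_of_gen_le_k) (simp add: frame_hom_def)
  then show ?case by simp
next
  case (insert a A)
  then have "inf (k (g a)) (meet_of (\<lambda>a. k (g a)) A) \<le> inf (k (g a)) (k (meet_of g A))"
    by (intro inf_mono order_refl)
  also have "\<dots> \<le> k (inf (g a) (meet_of g A))" by (rule inf_k_le)
  finally show ?case by simp
qed

lemma k_f_le: "cls_le Q (k (f g)) (gen g)"
  by (intro k_least coverage_gen) (blast intro: order_trans right_adjoint_counit[OF hom])

text \<open>This is the box relation with \<open>s = bot\<close>: each meet in
  \<open>\<rho> g\<close> belongs to the basis of \<open>q (f g)\<close>.\<close>

lemma gen_le_k_f: "cls_le Q (gen g) (k (f g))"
proof -
  have "gen g \<le> sup (gen bot) (gen g)" by simp
  also have "cls_le Q \<dots> (join_meet (\<lambda>b. gen (sup bot b)) (\<rho> g))" by (rule box_sup_le)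
  also have "join_meet (\<lambda>b. gen (sup bot b)) (\<rho> g) \<le> k (f g)"
    using \<rho>[of g] by (auto simp: directed_representation_def
        intro!: join_meet_least meet_of_gen_le_k intro: join_meet_upper)
  finally show ?thesis .
qed

lemma k_bot_le: "cls_le Q (k bot) bot"
proof (rule k_least)
  fix A assume "meet_of \<iota> A \<le> q bot"
  then have "cls_le Q (meet_of gen A) (gen bot)"
    by (intro coverage_gen) (simp add: \<iota>_bot frame_hom_bot[OF hom])
  then show "cls_le Q (meet_of gen A) bot" using box_bot_le by (rule cls_le_trans)
qed

text \<open>The box relations extend from generators to finite meets: they apply to each pair
  \<open>b\<close>, \<open>c\<close>, and the dual distributive law reassembles the meet over all
  pairs.\<close>

lemma meet_of_gen_le_sup:
  assumes "meet_of \<iota> A \<le> sup (meet_of \<iota> B) (q (r (meet_of \<iota> C)))"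
  shows "cls_le Q (meet_of gen A) (sup (meet_of gen B) (meet_of gen C))"
proof -
  have "cls_le Q (meet_of gen A) (sup (gen b) (gen c))" if b: "b |\<in>| B" and c: "c |\<in>| C" for b c
  proof -
    have "meet_of \<iota> A \<le> sup (\<iota> b) (q (f c))"
      using assms meet_of_lower[OF b] meet_of_lower[OF c]
      by (meson frame_hom_mono[OF hom] order_trans right_adjoint_mono sup_mono)
    also have "\<dots> = join_meet \<iota> ((|`|) (sup b) ` \<rho> c)"
      by (simp add: sup_\<rho> join_meet_image)
    finally have "cls_le Q (meet_of gen A) (join_meet gen ((|`|) (sup b) ` \<rho> c))"
      using sup_\<rho>(2)[of b c]
      by (intro coverage_directed) (simp_all add: image_image meet_of_fimage)
    also have "\<dots> = join_meet (\<lambda>x. gen (sup b x)) (\<rho> c)" by (rule join_meet_image)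
    also have "cls_le Q \<dots> (sup (gen b) (gen c))" by (rule box_sup_ge)
    finally show ?thesis .
  qed
  then have "cls_le Q (meet_of gen A) (meet_of (\<lambda>c. meet_of (\<lambda>b. sup (gen b) (gen c)) B) C)"
    by (intro cls_le_meet_of)
  also have "\<dots> = sup (meet_of gen B) (meet_of gen C)"
    by (simp only: meet_of_sup) (simp only: sup_meet_of)
  finally show ?thesis .
qed

text \<open>The composite of \<open>r\<close> and \<open>q\<close> fixes \<open>q y\<close> and
  preserves directed joins, so it can be applied to each member of the basis.\<close>

lemma q_eq_join: "q y = (SUP A\<in>basis (q y). q (r (meet_of \<iota> A)))"
proof -
  have dir: "directed (\<le>) (meet_of \<iota> ` basis (q y))"
    using directed_representation_basis by (simp add: directed_representation_def)
  have "q y = q (r (join_meet \<iota> (basis (q y))))" by (simp add: join_meet_basis)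
  also have "\<dots> = (SUP A\<in>basis (q y). q (r (meet_of \<iota> A)))"
    using proper dir by (simp add: proper_map_def join_meet_def image_image frame_hom_Sup)
  finally show ?thesis .
qed

lemma k_sup_le: "cls_le Q (k (sup x y)) (sup (k x) (k y))"
proof (rule k_least)
  fix A assume A: "meet_of \<iota> A \<le> q (sup x y)"
  \<comment> \<open>The second summand is wrapped in \<open>q\<close> and \<open>r\<close> to match
    the form that the box relations bound; by \<open>q_eq_join\<close> such elements still exhaust
    \<open>q y\<close>.\<close>
  define U where "U = {A. \<exists>B\<in>basis (q x). \<exists>C\<in>basis (q y).
    meet_of \<iota> A \<le> sup (meet_of \<iota> B) (q (r (meet_of \<iota> C)))}"
  have "cls_le Q (meet_of gen A) (join_meet gen U)"
  proof (rule coverage)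
    have "basis (q x) \<subseteq> U"
      using bot_in_basis[of "q y"] by (auto simp: U_def intro: le_supI1)
    then show "U \<noteq> {}" using bot_in_basis[of "q x"] by blast
    show "joins A1 A2 \<in> U" if "A1 \<in> U" "A2 \<in> U" for A1 A2
    proof -
      obtain B1 B2 C1 C2 where BC: "B1 \<in> basis (q x)" "B2 \<in> basis (q x)" "C1 \<in> basis (q y)" "C2 \<in> basis (q y)"
          "meet_of \<iota> A1 \<le> sup (meet_of \<iota> B1) (q (r (meet_of \<iota> C1)))"
          "meet_of \<iota> A2 \<le> sup (meet_of \<iota> B2) (q (r (meet_of \<iota> C2)))"
        using \<open>A1 \<in> U\<close> \<open>A2 \<in> U\<close> unfolding U_def by blast
      let ?u = "sup (meet_of \<iota> (joins B1 B2)) (q (r (meet_of \<iota> (joins C1 C2))))"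
      have "sup (meet_of \<iota> B) (q (r (meet_of \<iota> C))) \<le> ?u" if "B = B1 \<or> B = B2" "C = C1 \<or> C = C2" for B C
        using that by (intro sup_mono frame_hom_mono[OF hom] right_adjoint_mono)
          (auto simp: meet_of_joins \<iota>_sup)
      then have "meet_of \<iota> A1 \<le> ?u" "meet_of \<iota> A2 \<le> ?u"
        using BC(5,6) by (blast intro: order_trans)+
      then have "meet_of \<iota> (joins A1 A2) \<le> ?u"
        by (simp add: meet_of_joins[of \<iota> A1 A2] \<iota>_sup)
      then show ?thesis
        using BC(1-4) joins_basis unfolding U_def by blast
    qed
    have "q x \<le> join_meet \<iota> U"
      using \<open>basis (q x) \<subseteq> U\<close> by (subst join_meet_basis[symmetric])
        (simp add: join_meet_def SUP_subset_mono)
    moreover have "q y \<le> join_meet \<iota> U"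
    proof (subst q_eq_join, rule SUP_least)
      fix C assume C: "C \<in> basis (q y)"
      have "basis (q (r (meet_of \<iota> C))) \<subseteq> U"
      proof
        fix D assume "D \<in> basis (q (r (meet_of \<iota> C)))"
        then have "meet_of \<iota> D \<le> sup (meet_of \<iota> {|bot|}) (q (r (meet_of \<iota> C)))"
          by (simp add: basis_def le_supI2)
        with C bot_in_basis show "D \<in> U" unfolding U_def by blast
      qed
      then have "join_meet \<iota> (basis (q (r (meet_of \<iota> C)))) \<le> join_meet \<iota> U"
        by (simp add: join_meet_def SUP_subset_mono)
      then show "q (r (meet_of \<iota> C)) \<le> join_meet \<iota> U" by (simp add: join_meet_basis)
    qed
    ultimately show "meet_of \<iota> A \<le> join_meet \<iota> U"
      using A by (simp add: frame_hom_sup[OF hom]) (meson le_supI order_trans)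
  qed
  also have "cls_le Q \<dots> (sup (k x) (k y))"
  proof (rule cls_le_join_meet)
    fix A assume "A \<in> U"
    then obtain B C where BC: "B \<in> basis (q x)" "C \<in> basis (q y)"
        "meet_of \<iota> A \<le> sup (meet_of \<iota> B) (q (r (meet_of \<iota> C)))"
      unfolding U_def by blast
    then have "cls_le Q (meet_of gen A) (sup (meet_of gen B) (meet_of gen C))"
      by (intro meet_of_gen_le_sup)
    also have "\<dots> \<le> sup (k x) (k y)"
      using BC(1,2) by (intro sup_mono meet_of_gen_le_k) (simp_all add: basis_def)
    finally show "cls_le Q (meet_of gen A) (sup (k x) (k y))" .
  qed
  finally show "cls_le Q (meet_of gen A) (sup (k x) (k y))" .
qed

lemma k_Sup_le: "cls_le Q (k (Sup S)) (SUP y\<in>S. k y)"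
proof (rule k_least)
  fix A assume A: "meet_of \<iota> A \<le> q (Sup S)"
  \<comment> \<open>Finite subjoins form a directed family, so closure under \<open>joins\<close>
    comes from unions of finite sets; bottom and binary joins then settle each
    \<open>F\<close>.\<close>
  define U where "U = {A. \<exists>F\<subseteq>S. finite F \<and> meet_of \<iota> A \<le> q (Sup F)}"
  have "cls_le Q (meet_of gen A) (join_meet gen U)"
  proof (rule coverage)
    have "{|bot|} \<in> U"
      using bot_in_basis[of "q (Sup {})"] unfolding U_def basis_def by blast
    then show "U \<noteq> {}" by blast
    show "joins B C \<in> U" if "B \<in> U" "C \<in> U" for B C
    proof -
      obtain F where F: "F \<subseteq> S" "finite F" "meet_of \<iota> B \<le> q (Sup F)"
        using \<open>B \<in> U\<close> unfolding U_def by blast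
      obtain G where G: "G \<subseteq> S" "finite G" "meet_of \<iota> C \<le> q (Sup G)"
        using \<open>C \<in> U\<close> unfolding U_def by blast
      have "meet_of \<iota> (joins B C) \<le> q (Sup (F \<union> G))"
        using F(3) G(3)
        by (simp add: meet_of_joins \<iota>_sup Sup_union_distrib frame_hom_sup[OF hom] le_supI1 le_supI2)
      then show ?thesis using F G unfolding U_def
        by (intro CollectI exI[of _ "F \<union> G"]) simp
    qed
    have "q y \<le> join_meet \<iota> U" if "y \<in> S" for y
    proof -
      have "basis (q y) \<subseteq> U"
        using that by (auto simp: U_def basis_def intro!: exI[of _ "{y}"])
      then have "join_meet \<iota> (basis (q y)) \<le> join_meet \<iota> U"
        by (simp add: join_meet_def SUP_subset_mono)
      then show ?thesis by (simp add: join_meet_basis)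
    qed
    then have "q (Sup S) \<le> join_meet \<iota> U"
      by (simp add: frame_hom_Sup[OF hom] SUP_least)
    with A show "meet_of \<iota> A \<le> join_meet \<iota> U" by (rule order_trans)
  qed
  also have "cls_le Q \<dots> (SUP y\<in>S. k y)"
  proof (rule cls_le_join_meet)
    have finite: "cls_le Q (k (Sup F)) (SUP y\<in>F. k y)" if "finite F" for F
      using that
    proof induction
      case empty
      then show ?case using k_bot_le by simp
    next
      case (insert y F)
      have "cls_le Q (k (sup y (Sup F))) (sup (k y) (k (Sup F)))" by (rule k_sup_le)
      also have "cls_le Q \<dots> (sup (k y) (SUP y\<in>F. k y))"
        using insert.IH by (intro cls_le_sup) (auto intro: cls_le_of_le cls_le_le_trans)
      finally show ?case by simp
    qed
    fix A assume "A \<in> U"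
    then obtain F where F: "F \<subseteq> S" "finite F" "meet_of \<iota> A \<le> q (Sup F)"
      unfolding U_def by blast
    then have "meet_of gen A \<le> k (Sup F)" by (intro meet_of_gen_le_k)
    also have "cls_le Q \<dots> (SUP y\<in>F. k y)" using F(2) by (rule finite)
    also have "\<dots> \<le> (SUP y\<in>S. k y)" using F(1) by (intro SUP_subset_mono) auto
    finally show "cls_le Q (meet_of gen A) (SUP y\<in>S. k y)" .
  qed
  finally show "cls_le Q (meet_of gen A) (SUP y\<in>S. k y)" .
qed

section \<open>The composite of \<open>free_ext f\<close> and \<open>k\<close>, and the
  isomorphism\<close>

lemma le_k_free_ext: "cls_le Q u (k (free_ext f u))"
proof -
  have "cls_le Q (join_meet gen (Rep_free_frame u)) (k (free_ext f u))"
  proof (rule cls_le_join_meet)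
    fix A assume A: "A \<in> Rep_free_frame u"
    have "cls_le Q (meet_of gen A) (meet_of (\<lambda>a. k (f a)) A)"
      by (blast intro: cls_le_meet_of le_cls_le_trans meet_of_lower gen_le_k_f)
    also have "\<dots> \<le> k (meet_of f A)" by (rule meet_of_k_le)
    also have "\<dots> \<le> k (free_ext f u)"
      using A by (intro k_mono) (simp add: free_ext_def join_meet_upper)
    finally show "cls_le Q (meet_of gen A) (k (free_ext f u))" .
  qed
  then show ?thesis by (simp add: free_frame_expand[symmetric])
qed

text \<open>\<open>k_Sup_le\<close> reduces to a single finite meet, where monotonicity of
  \<open>k\<close> and \<open>k_f_le\<close> bound each generator.\<close>

lemma k_free_ext_le: "cls_le Q (k (free_ext f u)) u"
proof -
  have "cls_le Q (k (free_ext f u)) (SUP y\<in>meet_of f ` Rep_free_frame u. k y)"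
    unfolding free_ext_def join_meet_def by (rule k_Sup_le)
  also have "cls_le Q \<dots> u"
  proof (rule cls_le_SUP)
    fix y assume "y \<in> meet_of f ` Rep_free_frame u"
    then obtain A where A: "A \<in> Rep_free_frame u" and y: "y = meet_of f A" by blast
    have "cls_le Q (k y) (meet_of gen A)"
      unfolding y by (blast intro: cls_le_meet_of le_cls_le_trans k_mono meet_of_lower k_f_le)
    also have "\<dots> \<le> u" using A by (simp add: meet_of_gen_le_iff)
    finally show "cls_le Q (k y) u" .
  qed
  finally show ?thesis .
qed

lemma free_ext_f_surj: "\<exists>u. free_ext f u = y"
proof -
  have "directed (\<le>) (meet_of \<iota> ` basis (q y))"
    using directed_representation_basis by (simp add: directed_representation_def)
  then have "r (join_meet \<iota> (basis (q y))) = join_meet f (basis (q y))"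
    by (rule right_adjoint_join_meet[OF proper])
  then have "free_ext f (join_meet gen (basis (q y))) = y"
    using free_ext_join_meet[of f "\<lambda>g. g"] by (simp add: join_meet_basis)
  then show ?thesis by blast
qed

theorem ex_presentation_iso: "\<exists>\<psi> :: 'g free_frame set \<Rightarrow> 'y. presentation_iso Q \<psi>"
proof -
  obtain \<psi> :: "'g free_frame set \<Rightarrow> 'y"
    where \<psi>: "frame_hom (\<lambda>u. \<psi> (cls Q u))" "\<And>g. \<psi> (cls Q (gen g)) = f g"
    using presented_frame_universal[of Q f] validates by blast
  have "(\<lambda>u. \<psi> (cls Q u)) = free_ext f" by (rule free_ext_unique) (rule \<psi>)+
  then have \<psi>_cls: "\<psi> (cls Q u) = free_ext f u" for u by (rule fun_cong)
  have frame: "presented_frame Q = range (cls Q)"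
    by (auto simp: presented_frame_def cls_def quotient_def)
  \<comment> \<open>Both elements are equivalent to \<open>k\<close> of their common value.\<close>
  have "cls_le Q u v" if "free_ext f u = free_ext f v" for u v
    using cls_le_trans[OF le_k_free_ext[of u]] k_free_ext_le[of v] that by simp
  then have inj: "cls Q u = cls Q v" if "free_ext f u = free_ext f v" for u v
    using that by (intro cls_le_antisym) simp_all
  have "inj_on \<psi> (presented_frame Q)"
    unfolding frame by (rule inj_onI) (metis inj \<psi>_cls rangeE)
  moreover have "\<psi> ` presented_frame Q = range (free_ext f)"
    by (simp add: frame image_image \<psi>_cls)
  moreover have "range (free_ext f) = UNIV"
    using free_ext_f_surj by (metis surj_def)
  ultimately have "bij_betw \<psi> (presented_frame Q) UNIV"
    by (simp add: bij_betw_def)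
  with \<psi>(1) show ?thesis by (auto simp: presentation_iso_def)
qed

end

section \<open>Arbitrary representations with order relations, and the basis representation without
  them\<close>

theorem corollary3p5:
  fixes R :: "('g::bounded_semilattice_sup_bot fset set \<times> 'g fset set) set"
    and \<phi> :: "'g free_frame set \<Rightarrow> 'x::frame"
    and \<iota> :: "'g \<Rightarrow> 'x"
    and q :: "'y::frame \<Rightarrow> 'x"
  assumes "preframe_type R"
    and "presentation_iso (semilattice_presentation R) \<phi>"
    and "\<And>g. \<iota> g = \<phi> (cls (semilattice_presentation R) (gen g))"
    and "proper_quotient q"
  shows "(\<forall>\<rho>. (\<forall>t. directed_representation \<iota> (q (right_adjoint q (\<iota> t))) (\<rho> t)) \<longrightarrow>
            (\<exists>\<psi> :: 'g free_frame set \<Rightarrow> 'y.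
               presentation_iso (formal_relations R \<union> order_relations \<union> box_relations \<rho>) \<psi>))
       \<and> (\<exists>\<rho>. (\<forall>t. directed_representation \<iota> (q (right_adjoint q (\<iota> t))) (\<rho> t)) \<and>
            (\<exists>\<psi> :: 'g free_frame set \<Rightarrow> 'y.
               presentation_iso (formal_relations R \<union> box_relations \<rho>) \<psi>))"
proof (intro conjI allI impI)
  interpret presented_quotient R \<phi> \<iota> q
    using assms by unfold_locales
  show "\<exists>\<psi> :: 'g free_frame set \<Rightarrow> 'y.
      presentation_iso (formal_relations R \<union> order_relations \<union> box_relations \<rho>) \<psi>"
    if \<rho>: "\<forall>t. directed_representation \<iota> (q (right_adjoint q (\<iota> t))) (\<rho> t)" for \<rho>
  proof -
    interpret box_presentation R \<phi> \<iota> q \<rho> "formal_relations R \<union> order_relations \<union> box_relations \<rho>"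
      using \<rho> by unfold_locales (auto simp: order_relations_def intro!: cls_le_relation)
    show ?thesis by (rule ex_presentation_iso)
  qed
  define \<rho> where "\<rho> t = basis (q (r (\<iota> t)))" for t
  have \<rho>: "directed_representation \<iota> (q (r (\<iota> t))) (\<rho> t)" for t
    unfolding \<rho>_def by (rule directed_representation_basis)
  let ?Q = "formal_relations R \<union> box_relations \<rho>"
  have mono: "cls_le ?Q (gen s) (gen t)" if "s \<le> t" for s t
  proof -
    have rel: "cls_le ?Q (sup (gen bot) (gen t)) (join_meet (\<lambda>b. gen (sup bot b)) (\<rho> t))"
      "cls_le ?Q (join_meet (\<lambda>b. gen (sup bot b)) (\<rho> t)) (sup (gen bot) (gen t))" for t
      by (rule cls_le_relation; force simp: box_relations_def eqs_def)+
    have bot: "cls_le ?Q (gen bot) bot"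
      by (rule cls_le_relation) (simp add: box_relations_def eqs_def)
    \<comment> \<open>The basis grows with its element, so the instances with bottom as first
      argument compare the two boxes.\<close>
    have "\<rho> s \<subseteq> \<rho> t"
      using frame_hom_mono[OF hom right_adjoint_mono[OF \<iota>_mono[OF that], of q]]
      by (auto simp: \<rho>_def basis_def)
    have "gen s \<le> sup (gen bot) (gen s)" by simp
    also have "cls_le ?Q \<dots> (join_meet (\<lambda>b. gen (sup bot b)) (\<rho> s))" by (rule rel)
    also have "\<dots> \<le> join_meet (\<lambda>b. gen (sup bot b)) (\<rho> t)"
      using \<open>\<rho> s \<subseteq> \<rho> t\<close> by (simp add: join_meet_def SUP_subset_mono)
    also have "cls_le ?Q \<dots> (sup (gen bot) (gen t))" by (rule rel)
    also have "cls_le ?Q \<dots> (gen t)"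
      using bot by (intro cls_le_sup) (auto intro: cls_le_of_le cls_le_le_trans)
    finally show ?thesis .
  qed
  interpret box_presentation R \<phi> \<iota> q \<rho> ?Q
    using \<rho> mono by unfold_locales auto
  show "\<exists>\<rho>. (\<forall>t. directed_representation \<iota> (q (right_adjoint q (\<iota> t))) (\<rho> t)) \<and>
            (\<exists>\<psi> :: 'g free_frame set \<Rightarrow> 'y.
               presentation_iso (formal_relations R \<union> box_relations \<rho>) \<psi>)"
    using \<rho> ex_presentation_iso by blast
qed

end
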